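(* Let $\omega$ be a Bismut Einstein metric with Einstein constant $\lambda\in\mathbb{R}$ on a complex manifold (i.e. $\partial\bar\partial\omega=0$ and $\rho^{1,1}(\omega)=\lambda\omega$), and let $\phi=-\sqrt{-1}\,\rho^{2,0}(\omega)$, with components $\phi_{ij}$. Then $$\Delta\phi=-\lambda\phi .$$ Moreover, if $\lambda\neq0$, then $\lambda T+\overline{\nabla}\phi=0$, i.e. in local holomorphic coordinates $\lambda T_{ij\bar k}+\nabla_{\bar k}\phi_{ij}=0$ for all $i,j,k$.
   Context: For a Hermitian metric $g$ on a complex manifold $(M,J)$, the fundamental form is $\omega(\cdot,\cdot)=g(J\cdot,\cdot)$, locally $\omega=\sqrt{-1}\,g_{i\bar j}\,dz^i\wedge d\bar z^j$, and $(g^{\bar j i})$ denotes the inverse matrix of $(g_{i\bar j})$. The Ricci form $\rho$ of the Bismut connection (the unique connection preserving $g$ and $J$ with totally skew-symmetric torsion) is a closed real 2-form $\rho=\rho^{1,1}+\rho^{2,0}+\overline{\rho^{2,0}}$, with $$\rho^{1,1}(\omega)=-\partial\partial^*\omega-\bar\partial\bar\partial^*\omega-\sqrt{-1}\,\partial\bar\partial\log\det g,\qquad \rho^{2,0}(\omega)=-\partial\bar\partial^*\omega,$$ where $\partial^*,\bar\partial^*$ are formal $L^2$-adjoints. Write $\rho^{2,0}=\frac{\sqrt{-1}}{2}\phi_{ij}\,dz^i\wedge dz^j$ with $\phi_{ij}+\phi_{ji}=0$. $\nabla$ is the Chern connection, with Christoffel symbols $\Gamma_{ij}^{s}=g^{\bar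 t s}\partial_i g_{j\bar t}$ and torsion $T_{ij\bar t}=\partial_i g_{j\bar t}-\partial_j g_{i\bar t}$. The Chern Laplacian on tensors is $\Delta=g^{\bar q p}\nabla_p\nabla_{\bar q}$, and $\overline{\nabla}$ denotes the $(0,1)$-part of the Chern covariant derivative. *)

theory Defs
  imports "HOL-Analysis.Analysis"
begin

section \<open>Smooth and holomorphic maps\<close>

text \<open>Only used for open \<open>S\<close>; smoothness is in the real sense.\<close>

fun C_k_on :: "nat \<Rightarrow> ('a::real_normed_vector \<Rightarrow> 'b::real_normed_vector) \<Rightarrow> 'a set \<Rightarrow> bool" where
  "C_k_on 0 f S \<longleftrightarrow> continuous_on S f"
| "C_k_on (Suc k) f S \<longleftrightarrow> (\<forall>x\<in>S. f differentiable (at x)) \<and>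
     (\<forall>v. C_k_on k (\<lambda>x. frechet_derivative f (at x) v) S)"

definition smooth_on :: "('a::real_normed_vector \<Rightarrow> 'b::real_normed_vector) \<Rightarrow> 'a set \<Rightarrow> bool" where
  "smooth_on f S \<longleftrightarrow> (\<forall>k. C_k_on k f S)"

definition holomorphic_map_on :: "(complex^'n \<Rightarrow> complex^'n) \<Rightarrow> (complex^'n) set \<Rightarrow> bool" where
  "holomorphic_map_on F S \<longleftrightarrow>
     (\<forall>x\<in>S. \<exists>D. (F has_derivative D) (at x) \<and> (\<forall>c v. D (c *s v) = c *s D v))"

text \<open>The Wirtinger derivatives \<open>\<partial>/\<partial>z\<^sup>i\<close> and \<open>\<partial>/\<partial>(cnj z\<^sup>i)\<close>.\<close>

definition dz :: "'n \<Rightarrow> (complex^'n \<Rightarrow> complex) \<Rightarrow> complex^'n \<Rightarrow> complex" where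
  "dz i f x = (frechet_derivative f (at x) (axis i 1)
                - \<i> * frechet_derivative f (at x) (axis i \<i>)) / 2"

definition dzbar :: "'n \<Rightarrow> (complex^'n \<Rightarrow> complex) \<Rightarrow> complex^'n \<Rightarrow> complex" where
  "dzbar i f x = (frechet_derivative f (at x) (axis i 1)
                + \<i> * frechet_derivative f (at x) (axis i \<i>)) / 2"

section \<open>Complex manifolds and Hermitian metrics\<close>

text \<open>A chart is an open set together with a holomorphic coordinate map on it.\<close>

type_synonym ('a, 'n) chart = "'a set \<times> ('a \<Rightarrow> complex^'n)"

definition coord_dom :: "('a, 'n) chart \<Rightarrow> (complex^'n) set" where
  "coord_dom c = snd c ` fst c"

definition transition :: "('a, 'n) chart \<Rightarrow> ('a, 'n) chart \<Rightarrow> complex^'n \<Rightarrow> complex^'n" where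
  "transition c d = snd d \<circ> inv_into (fst c) (snd c)"

text \<open>The atlas need not be maximal.\<close>

definition complex_manifold :: "'a topology \<Rightarrow> ('a, 'n::finite) chart set \<Rightarrow> bool" where
  "complex_manifold M A \<longleftrightarrow>
     Hausdorff_space M \<and> second_countable M \<and>
     (\<Union>c\<in>A. fst c) = topspace M \<and>
     (\<forall>c\<in>A. openin M (fst c) \<and> open (coord_dom c) \<and>
        homeomorphic_map (subtopology M (fst c)) (top_of_set (coord_dom c)) (snd c)) \<and>
     (\<forall>c\<in>A. \<forall>d\<in>A. holomorphic_map_on (transition c d) (snd c ` (fst c \<inter> fst d)))"

text \<open>
  In a chart the real tangent space is the underlying real vector space of \<open>\<complex>\<^sup>n\<close>, with complex
  structure \<open>J u = \<i> u\<close>. A tensor field on the manifold is given by its coordinate expressions in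
  all charts of the atlas, subject to the transformation law.
\<close>

type_synonym 'n local_metric = "complex^'n \<Rightarrow> complex^'n \<Rightarrow> complex^'n \<Rightarrow> real"

definition hermitian_metric ::
    "('a, 'n::finite) chart set \<Rightarrow> (('a, 'n) chart \<Rightarrow> 'n local_metric) \<Rightarrow> bool" where
  "hermitian_metric A g \<longleftrightarrow>
     (\<forall>c\<in>A.
        (\<forall>u v. smooth_on (\<lambda>x. g c x u v) (coord_dom c)) \<and>
        (\<forall>x\<in>coord_dom c.
           bilinear (g c x) \<and>
           (\<forall>u v. g c x u v = g c x v u) \<and>
           (\<forall>u. u \<noteq> 0 \<longrightarrow> g c x u u > 0) \<and>
           (\<forall>u v. g c x (\<i> *s u) (\<i> *s v) = g c x u v))) \<and>
     (\<forall>c\<in>A. \<forall>d\<in>A. \<forall>x\<in>snd c ` (fst c \<inter> fst d). \<forall>u v.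
        g c x u v = g d (transition c d x)
          (frechet_derivative (transition c d) (at x) u)
          (frechet_derivative (transition c d) (at x) v))"

text \<open>
  The value on \<open>(\<partial>\<^sub>i, \<partial>\<^sub>j')\<close> of the complex bilinear extension of a real bilinear form, where
  \<open>\<partial>\<^sub>i = (e\<^sub>i - \<i> J e\<^sub>i)/2\<close> and \<open>\<partial>\<^sub>j' = (e\<^sub>j + \<i> J e\<^sub>j)/2\<close>; primes mark conjugate indices.
\<close>

definition mixed_component :: "(complex^'n \<Rightarrow> complex^'n \<Rightarrow> real) \<Rightarrow> 'n \<Rightarrow> 'n \<Rightarrow> complex" where
  "mixed_component b i j =
     (of_real (b (axis i 1) (axis j 1)) + of_real (b (axis i \<i>) (axis j \<i>))
      + \<i> * of_real (b (axis i 1) (axis j \<i>)) - \<i> * of_real (b (axis i \<i>) (axis j 1))) / 4"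

text \<open>The matrix \<open>g\<^sub>i\<^sub>j'\<close>; \<open>metric_inv b x $ j $ i\<close> is \<open>g\<close> with upper indices \<open>(j', i)\<close>.\<close>

definition metric_matrix :: "'n::finite local_metric \<Rightarrow> complex^'n \<Rightarrow> complex^'n^'n" where
  "metric_matrix b x = (\<chi> i j. mixed_component (b x) i j)"

definition metric_inv :: "'n::finite local_metric \<Rightarrow> complex^'n \<Rightarrow> complex^'n^'n" where
  "metric_inv b x = matrix_inv (metric_matrix b x)"

section \<open>Covariant tensors and differential forms in a chart\<close>

text \<open>
  \<open>t is js x\<close> is the value of the tensor \<open>t\<close> at \<open>x\<close> on the vectors \<open>\<partial>\<^sub>i\<close> for \<open>i\<close> in \<open>is\<close>, followed by
  the conjugate vectors \<open>\<partial>\<^sub>j'\<close> for \<open>j\<close> in \<open>js\<close>. A \<open>(p,q)\<close>-form \<open>\<alpha>\<close> is recorded by its values for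
  lists of lengths \<open>p\<close> and \<open>q\<close> (the other values are irrelevant), so that
  \<open>\<alpha> = 1/(p! q!) \<Sum> \<alpha>\<^sub>I\<^sub>J dz\<^sup>I \<and> cnj (dz\<^sup>J)\<close> with the sum over all multi-indices of these lengths.
\<close>

type_synonym 'n tensor = "'n list \<Rightarrow> 'n list \<Rightarrow> complex^'n \<Rightarrow> complex"

definition form_on :: "nat \<Rightarrow> nat \<Rightarrow> (complex^'n::finite) set \<Rightarrow> 'n tensor \<Rightarrow> bool" where
  "form_on p q V \<alpha> \<longleftrightarrow>
     (\<forall>is js. length is = p \<and> length js = q \<longrightarrow>
        smooth_on (\<alpha> is js) V \<and>
        (\<forall>x\<in>V.
          (\<forall>a<p. \<forall>b<p. a \<noteq> b \<longrightarrow> \<alpha> (is[a := is ! b, b := is ! a]) js x = - \<alpha> is js x) \<and>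
          (\<forall>a<q. \<forall>b<q. a \<noteq> b \<longrightarrow> \<alpha> is (js[a := js ! b, b := js ! a]) x = - \<alpha> is js x)))"

definition remove_nth :: "nat \<Rightarrow> 'b list \<Rightarrow> 'b list" where
  "remove_nth a xs = take a xs @ drop (Suc a) xs"

text \<open>
  The operators \<open>del\<close> and \<open>delbar\<close>, normalised so that
  \<open>d = del + delbar\<close>; the sign \<open>(-1)\<^sup>p\<close> in \<open>delbar\<close> comes from moving
  \<open>cnj (dz\<^sup>j)\<close> past the \<open>p\<close> factors \<open>dz\<^sup>i\<close>.
\<close>

definition del :: "'n::finite tensor \<Rightarrow> 'n tensor" where
  "del \<alpha> is js x =
     (\<Sum>a<length is. (-1) ^ a * dz (is ! a) (\<alpha> (remove_nth a is) js) x)"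

definition delbar :: "'n::finite tensor \<Rightarrow> 'n tensor" where
  "delbar \<alpha> is js x =
     (-1) ^ length is * (\<Sum>b<length js. (-1) ^ b * dzbar (js ! b) (\<alpha> is (remove_nth b js)) x)"

text \<open>
  The pointwise Hermitian inner product of \<open>(p,q)\<close>-forms, for which
  \<open>\<langle>dz\<^sup>i, dz\<^sup>k\<rangle>\<close> is the entry \<open>(k', i)\<close> of the inverse metric,
  and which is given on decomposable forms by determinants.
\<close>

definition form_inner ::
    "nat \<Rightarrow> nat \<Rightarrow> 'n::finite local_metric \<Rightarrow> 'n tensor \<Rightarrow> 'n tensor \<Rightarrow> complex^'n \<Rightarrow> complex" where
  "form_inner p q b \<alpha> \<beta> x =
     (\<Sum>is | length is = p. \<Sum>js | length js = q. \<Sum>ks | length ks = p. \<Sum>ls | length ls = q.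
        \<alpha> is js x * cnj (\<beta> ks ls x) *
        (\<Prod>a<p. metric_inv b x $ (ks ! a) $ (is ! a)) *
        (\<Prod>a<q. metric_inv b x $ (js ! a) $ (ls ! a))) / (fact p * fact q)"

text \<open>
  The \<open>L\<^sup>2\<close> inner product over \<open>V\<close>. The Riemannian volume is
  \<open>2\<^sup>n det (g\<^sub>i\<^sub>j')\<close> times Lebesgue measure.
\<close>

definition L2_inner ::
    "nat \<Rightarrow> nat \<Rightarrow> (complex^'n::finite) set \<Rightarrow> 'n local_metric \<Rightarrow> 'n tensor \<Rightarrow> 'n tensor \<Rightarrow> complex"
  where
  "L2_inner p q V b \<alpha> \<beta> =
     (LINT x:V|lborel. form_inner p q b \<alpha> \<beta> x * (2 ^ CARD('n) * det (metric_matrix b x)))"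

definition test_form :: "nat \<Rightarrow> nat \<Rightarrow> (complex^'n::finite) set \<Rightarrow> 'n tensor \<Rightarrow> bool" where
  "test_form p q V \<eta> \<longleftrightarrow> form_on p q UNIV \<eta> \<and>
     (\<exists>K. compact K \<and> K \<subseteq> V \<and>
        (\<forall>is js x. length is = p \<and> length js = q \<and> x \<notin> K \<longrightarrow> \<eta> is js x = 0))"

text \<open>
  The formal adjoints \<open>del\<^sup>*\<close> and \<open>delbar\<^sup>*\<close> applied to a \<open>(p,q)\<close>-form.
  On \<open>V\<close> (open) the components of degree \<open>(p-1,q)\<close>, respectively \<open>(p,q-1)\<close>, are uniquely determined.
\<close>

definition del_adj ::
    "nat \<Rightarrow> nat \<Rightarrow> (complex^'n::finite) set \<Rightarrow> 'n local_metric \<Rightarrow> 'n tensor \<Rightarrow> 'n tensor" where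
  "del_adj p q V b \<alpha> = (SOME \<beta>. form_on (p - 1) q V \<beta> \<and>
     (\<forall>\<eta>. test_form (p - 1) q V \<eta> \<longrightarrow>
        L2_inner (p - 1) q V b \<beta> \<eta> = L2_inner p q V b \<alpha> (del \<eta>)))"

definition delbar_adj ::
    "nat \<Rightarrow> nat \<Rightarrow> (complex^'n::finite) set \<Rightarrow> 'n local_metric \<Rightarrow> 'n tensor \<Rightarrow> 'n tensor" where
  "delbar_adj p q V b \<alpha> = (SOME \<beta>. form_on p (q - 1) V \<beta> \<and>
     (\<forall>\<eta>. test_form p (q - 1) V \<eta> \<longrightarrow>
        L2_inner p (q - 1) V b \<beta> \<eta> = L2_inner p q V b \<alpha> (delbar \<eta>)))"

section \<open>The Bismut Ricci form\<close>

text \<open>The fundamental form \<open>\<omega>(u,v) = g(J u, v)\<close>, a \<open>(1,1)\<close>-form.\<close>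

definition fundamental_form :: "'n::finite local_metric \<Rightarrow> 'n tensor" where
  "fundamental_form b is js x =
     (case (is, js) of ([i], [j]) \<Rightarrow> mixed_component (\<lambda>u v. b x (\<i> *s u) v) i j | _ \<Rightarrow> 0)"

definition log_det :: "'n::finite local_metric \<Rightarrow> 'n tensor" where
  "log_det b is js x = ln (det (metric_matrix b x))"

definition rho11 :: "(complex^'n::finite) set \<Rightarrow> 'n local_metric \<Rightarrow> 'n tensor" where
  "rho11 V b is js x =
     - del (del_adj 1 1 V b (fundamental_form b)) is js x
     - delbar (delbar_adj 1 1 V b (fundamental_form b)) is js x
     - \<i> * del (delbar (log_det b)) is js x"

definition rho20 :: "(complex^'n::finite) set \<Rightarrow> 'n local_metric \<Rightarrow> 'n tensor" where
  "rho20 V b is js x = - del (delbar_adj 1 1 V b (fundamental_form b)) is js x"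

definition bismut_einstein ::
    "('a, 'n::finite) chart set \<Rightarrow> (('a, 'n) chart \<Rightarrow> 'n local_metric) \<Rightarrow> real \<Rightarrow> bool" where
  "bismut_einstein A g l \<longleftrightarrow>
     (\<forall>c\<in>A. \<forall>x\<in>coord_dom c.
        (\<forall>is js. length is = 2 \<and> length js = 2 \<longrightarrow>
           del (delbar (fundamental_form (g c))) is js x = 0) \<and>
        (\<forall>i j. rho11 (coord_dom c) (g c) [i] [j] x
             = of_real l * fundamental_form (g c) [i] [j] x))"

text \<open>The \<open>(2,0)\<close>-form \<open>\<phi> = -\<i> \<rho>\<^sup>2\<^sup>,\<^sup>0 = (1/2) \<phi>\<^sub>i\<^sub>j dz\<^sup>i \<and> dz\<^sup>j\<close>; its component
  \<open>\<phi>\<^sub>i\<^sub>j\<close> is \<open>phi V b [i, j] []\<close>.\<close>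

definition phi :: "(complex^'n::finite) set \<Rightarrow> 'n local_metric \<Rightarrow> 'n tensor" where
  "phi V b is js x = - \<i> * rho20 V b is js x"

section \<open>The Chern connection\<close>

text \<open>\<open>christoffel b i j s\<close> has upper index \<open>s\<close>.\<close>

definition christoffel :: "'n::finite local_metric \<Rightarrow> 'n \<Rightarrow> 'n \<Rightarrow> 'n \<Rightarrow> complex^'n \<Rightarrow> complex" where
  "christoffel b i j s x =
     (\<Sum>t\<in>UNIV. metric_inv b x $ t $ s * dz i (\<lambda>y. metric_matrix b y $ j $ t) x)"

text \<open>\<open>torsion b i j k\<close> has third index conjugate.\<close>

definition torsion :: "'n::finite local_metric \<Rightarrow> 'n \<Rightarrow> 'n \<Rightarrow> 'n \<Rightarrow> complex^'n \<Rightarrow> complex" where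
  "torsion b i j k x =
     dz i (\<lambda>y. metric_matrix b y $ j $ k) x - dz j (\<lambda>y. metric_matrix b y $ i $ k) x"

text \<open>Covariant derivatives along \<open>\<partial>\<^sub>p\<close> and along \<open>\<partial>\<^sub>q'\<close>; the Christoffel symbols with
  both barred and unbarred indices vanish.\<close>

definition nabla :: "'n::finite local_metric \<Rightarrow> 'n \<Rightarrow> 'n tensor \<Rightarrow> 'n tensor" where
  "nabla b p t is js x = dz p (t is js) x
     - (\<Sum>a<length is. \<Sum>s\<in>UNIV. christoffel b p (is ! a) s x * t (is[a := s]) js x)"

definition nabla_bar :: "'n::finite local_metric \<Rightarrow> 'n \<Rightarrow> 'n tensor \<Rightarrow> 'n tensor" where
  "nabla_bar b q t is js x = dzbar q (t is js) x
     - (\<Sum>a<length js. \<Sum>s\<in>UNIV. cnj (christoffel b q (js ! a) s x) * t is (js[a := s]) x)"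

text \<open>The \<open>(0,1)\<close>-part of the covariant derivative as a tensor, whose additional barred
  index comes first.\<close>

definition nabla_bar_tensor :: "'n::finite local_metric \<Rightarrow> 'n tensor \<Rightarrow> 'n tensor" where
  "nabla_bar_tensor b t is js x = nabla_bar b (hd js) t is (tl js) x"

definition chern_laplacian :: "'n::finite local_metric \<Rightarrow> 'n tensor \<Rightarrow> 'n tensor" where
  "chern_laplacian b t is js x =
     (\<Sum>p\<in>UNIV. \<Sum>q\<in>UNIV. metric_inv b x $ q $ p * nabla b p (nabla_bar_tensor b t) is (q # js) x)"

end

theory Submission
  imports Defs
begin

text \<open>
  All assertions concern one chart. Write \<open>\<partial>\<^sub>i\<close> and \<open>\<partial>\<^sub>j'\<close> for the Wirtinger derivatives, primes marking
  conjugate indices, \<open>G\<close> for the metric matrix, \<open>H\<close> for its inverse and \<open>T\<close> for the torsion (the last index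
  of \<open>G\<close> and \<open>T\<close> and the first one of \<open>H\<close> are conjugate). Let \<open>\<tau>\<^sub>i = \<Sum> H\<^sub>q\<^sub>l T\<^sub>i\<^sub>l\<^sub>q\<close> be the trace of the torsion,
  \<open>L = log det G\<close>, and \<open>\<lambda>\<close> the Einstein constant.

  The adjoints in the Ricci form are defined by choice from their defining \<open>L\<^sup>2\<close> identity. Integrating
  \<open>\<langle>\<omega>, delbar \<eta>\<rangle>\<close> by parts against a test form \<open>\<eta>\<close>, and computing the divergence of \<open>H det G\<close> with
  Jacobi's formula for the derivative of a determinant, shows that \<open>\<i> \<tau>\<^sub>i dz\<^sup>i\<close> satisfies the identity for
  \<open>delbar\<^sup>* \<omega>\<close>, and its conjugate the one for \<open>del\<^sup>* \<omega>\<close>. By the fundamental lemma of the calculus of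
  variations, for which smooth bump functions are needed, the identity has no other solution
  (\<open>delbar_adj_fundamental_form\<close>, \<open>del_adj_fundamental_form\<close>). Hence
  \<open>\<phi>\<^sub>i\<^sub>j = \<partial>\<^sub>j \<tau>\<^sub>i - \<partial>\<^sub>i \<tau>\<^sub>j\<close>, and the equation \<open>\<rho>\<^sup>1\<^sup>,\<^sup>1 = \<lambda> \<omega>\<close> reads
  \<open>\<partial>\<^sub>k' \<tau>\<^sub>i = \<lambda> G\<^sub>i\<^sub>k + \<partial>\<^sub>i \<partial>\<^sub>k' L - \<partial>\<^sub>i (cnj \<tau>\<^sub>k)\<close>.

  Apply \<open>\<partial>\<^sub>j\<close> to this equation and antisymmetrise in \<open>i\<close> and \<open>j\<close>. Partial derivatives commute, so the last
  two terms disappear and \<open>\<partial>\<^sub>k' \<phi>\<^sub>i\<^sub>j = - \<lambda> T\<^sub>i\<^sub>j\<^sub>k\<close> remains (\<open>dzbar_phi\<close>); this is the part of type \<open>(2,1)\<close> of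
  the closedness of the Ricci form. No Christoffel symbol enters the \<open>(0,1)\<close>-derivative of a
  \<open>(2,0)\<close>-form, so this is the second assertion.

  The Laplacian of \<open>\<phi>\<close> is therefore \<open>- \<lambda>\<close> times the divergence \<open>\<Sum> H\<^sub>q\<^sub>p \<nabla>\<^sub>p T\<^sub>i\<^sub>j\<^sub>q\<close>, and the first assertion
  says that this divergence is \<open>\<phi>\<^sub>i\<^sub>j\<close> (\<open>divergence_torsion\<close>). The cyclic sum of \<open>\<partial>\<^sub>p T\<^sub>i\<^sub>j\<^sub>q\<close> over \<open>p, i, j\<close>
  vanishes. Its trace over \<open>p\<close> and \<open>q\<close> expresses \<open>\<Sum> H\<^sub>q\<^sub>p \<partial>\<^sub>p T\<^sub>i\<^sub>j\<^sub>q\<close> by the derivatives of \<open>\<tau>\<close> and terms in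
  the Christoffel symbols. Together with the Christoffel terms of \<open>\<nabla>\<^sub>p\<close> these add up to an expression
  quadratic in the torsion that is the difference of two traces interchanged by \<open>i\<close> and \<open>j\<close>, but the
  trace is symmetric in \<open>i\<close> and \<open>j\<close> (\<open>trace_torsion_square\<close>).
\<close>

section \<open>Calculus of smooth functions\<close>

lemma C_k_on_cong:
  assumes "open S" "\<And>x. x \<in> S \<Longrightarrow> f x = g x" "C_k_on k f S"
  shows "C_k_on k g S"
  using assms(2,3)
proof (induction k arbitrary: f g)
  case 0
  then show ?case using continuous_on_cong[of S S f g] by simp
next
  case (Suc k)
  have d: "(g has_derivative frechet_derivative f (at x)) (at x)" if "x \<in> S" for x
  proof -
    have "(f has_derivative frechet_derivative f (at x)) (at x)"
      using Suc.prems(2) that by (simp add: frechet_derivative_works)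
    then show ?thesis
      by (rule has_derivative_transform_within_open[OF _ \<open>open S\<close> that]) (use Suc.prems in auto)
  qed
  have "C_k_on k (\<lambda>x. frechet_derivative g (at x) v) S" for v
    by (rule Suc.IH[of "\<lambda>x. frechet_derivative f (at x) v"])
      (use Suc.prems frechet_derivative_at[OF d] in auto)
  with d show ?case by (auto simp: differentiable_def)
qed

text \<open>
  The predicate \<open>C_k_on\<close> speaks of \<open>frechet_derivative\<close>, a term defined by choice. With this rule a
  derivative may be given by any formula that is valid on the open set \<open>S\<close>; the closure properties
  below then follow by induction on \<open>k\<close> from the usual differentiation rules.
\<close>

lemma C_k_on_SucI:
  assumes "open S" and d: "\<And>x. x \<in> S \<Longrightarrow> (f has_derivative f' x) (at x)"
    and "\<And>v. C_k_on k (\<lambda>x. f' x v) S"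
  shows "C_k_on (Suc k) f S"
proof -
  have "C_k_on k (\<lambda>x. frechet_derivative f (at x) v) S" for v
    by (rule C_k_on_cong[OF \<open>open S\<close> _ assms(3)]) (simp add: frechet_derivative_at[OF d, symmetric])
  with d show ?thesis by (auto simp: differentiable_def)
qed

lemma C_k_on_has_derivative:
  assumes "C_k_on (Suc k) f S" "x \<in> S"
  shows "(f has_derivative frechet_derivative f (at x)) (at x)"
  using assms by (simp add: frechet_derivative_works)

lemma C_k_on_Suc_imp: "C_k_on (Suc k) f S \<Longrightarrow> C_k_on k f S"
proof (induction k arbitrary: f)
  case 0
  then show ?case
    by (auto intro!: continuous_at_imp_continuous_on differentiable_imp_continuous_within)
next
  case (Suc k)
  then show ?case by (metis C_k_on.simps(2))
qed

lemma C_k_on_imp_continuous_on: "C_k_on k f S \<Longrightarrow> continuous_on S f"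
  by (induction k) (use C_k_on_Suc_imp C_k_on.simps(1) in blast)+

lemma C_k_on_subset: "C_k_on k f T \<Longrightarrow> S \<subseteq> T \<Longrightarrow> C_k_on k f S"
  by (induction k arbitrary: f) (auto intro: continuous_on_subset)

lemma C_k_on_Un:
  "open S \<Longrightarrow> open T \<Longrightarrow> C_k_on k f S \<Longrightarrow> C_k_on k f T \<Longrightarrow> C_k_on k f (S \<union> T)"
  by (induction k arbitrary: f) (auto intro: continuous_on_open_Un)

lemma C_k_on_const: "open S \<Longrightarrow> C_k_on k (\<lambda>x. c) S"
  by (induction k arbitrary: c) auto

lemma C_k_on_add:
  assumes "open S" "C_k_on k f S" "C_k_on k g S"
  shows "C_k_on k (\<lambda>x. f x + g x) S"
  using assms(2,3)
proof (induction k arbitrary: f g)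
  case 0
  then show ?case by (auto intro: continuous_on_add)
next
  case (Suc k)
  show ?case
    by (rule C_k_on_SucI[OF \<open>open S\<close>
          has_derivative_add[OF C_k_on_has_derivative[OF Suc.prems(1)]
            C_k_on_has_derivative[OF Suc.prems(2)]]])
      (use Suc in auto)
qed

text \<open>
  Covers complex conjugation, real and imaginary part, and the embedding of the reals.
\<close>

lemma C_k_on_bounded_linear:
  assumes "open S" "bounded_linear L" "C_k_on k f S"
  shows "C_k_on k (\<lambda>x. L (f x)) S"
  using assms(3)
proof (induction k arbitrary: f)
  case 0
  then show ?case by (auto intro: bounded_linear.continuous_on[OF assms(2)])
next
  case (Suc k)
  show ?case
    by (rule C_k_on_SucI[OF \<open>open S\<close>
          bounded_linear.has_derivative[OF assms(2) C_k_on_has_derivative[OF Suc.prems]]])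
      (use Suc in auto)
qed

lemma C_k_on_bounded_bilinear:
  assumes "open S" "bounded_bilinear B" "C_k_on k f S" "C_k_on k g S"
  shows "C_k_on k (\<lambda>x. B (f x) (g x)) S"
  using assms(3,4)
proof (induction k arbitrary: f g)
  case 0
  then show ?case by (auto intro: bounded_bilinear.continuous_on[OF assms(2)])
next
  case (Suc k)
  have "C_k_on k f S" "C_k_on k g S"
    using Suc.prems by (auto intro: C_k_on_Suc_imp simp del: C_k_on.simps)
  then show ?case
    by (intro C_k_on_SucI[OF \<open>open S\<close>
          bounded_bilinear.FDERIV[OF assms(2) C_k_on_has_derivative[OF Suc.prems(1)]
            C_k_on_has_derivative[OF Suc.prems(2)]]] C_k_on_add[OF \<open>open S\<close>] Suc.IH)
      (use Suc.prems in auto)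
qed

lemma C_k_on_inverse:
  fixes f :: "'a::real_normed_vector \<Rightarrow> 'b::real_normed_field"
  assumes "open S" "\<And>x. x \<in> S \<Longrightarrow> f x \<noteq> 0" "C_k_on k f S"
  shows "C_k_on k (\<lambda>x. inverse (f x)) S"
  using assms(3)
proof (induction k)
  case 0
  then show ?case using assms(2) by (auto intro: continuous_on_inverse)
next
  case (Suc k)
  have k: "C_k_on k (\<lambda>x. inverse (f x)) S"
    using Suc.IH C_k_on_Suc_imp[OF Suc.prems] by blast
  show ?case
  proof (rule C_k_on_SucI[OF \<open>open S\<close>
          Deriv.has_derivative_inverse[OF assms(2) C_k_on_has_derivative[OF Suc.prems]]])
    fix v
    have "C_k_on k (\<lambda>x. inverse (f x) * frechet_derivative f (at x) v * inverse (f x)) S"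
      by (intro C_k_on_bounded_bilinear[OF \<open>open S\<close> bounded_bilinear_mult] k)
        (use Suc.prems in simp)
    then show "C_k_on k (\<lambda>x. - (inverse (f x) * frechet_derivative f (at x) v * inverse (f x))) S"
      by (rule C_k_on_bounded_linear[OF \<open>open S\<close> bounded_linear_minus[OF bounded_linear_ident]])
  qed
qed

lemma smooth_on_cong:
  "smooth_on f S \<Longrightarrow> open S \<Longrightarrow> (\<And>x. x \<in> S \<Longrightarrow> f x = g x) \<Longrightarrow> smooth_on g S"
  unfolding smooth_on_def by (blast intro: C_k_on_cong)

lemma smooth_on_subset: "smooth_on f T \<Longrightarrow> S \<subseteq> T \<Longrightarrow> smooth_on f S"
  unfolding smooth_on_def by (blast intro: C_k_on_subset)

lemma smooth_on_const: "open S \<Longrightarrow> smooth_on (\<lambda>x. c) S"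
  unfolding smooth_on_def by (blast intro: C_k_on_const)

lemma smooth_on_add:
  "open S \<Longrightarrow> smooth_on f S \<Longrightarrow> smooth_on g S \<Longrightarrow> smooth_on (\<lambda>x. f x + g x) S"
  unfolding smooth_on_def by (blast intro: C_k_on_add)

lemma smooth_on_bounded_linear:
  "open S \<Longrightarrow> bounded_linear L \<Longrightarrow> smooth_on f S \<Longrightarrow> smooth_on (\<lambda>x. L (f x)) S"
  unfolding smooth_on_def by (blast intro: C_k_on_bounded_linear)

lemma smooth_on_mult:
  fixes f g :: "'a::real_normed_vector \<Rightarrow> 'b::real_normed_algebra"
  shows "open S \<Longrightarrow> smooth_on f S \<Longrightarrow> smooth_on g S \<Longrightarrow> smooth_on (\<lambda>x. f x * g x) S"
  unfolding smooth_on_def by (blast intro: C_k_on_bounded_bilinear bounded_bilinear_mult)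

lemma smooth_on_inverse:
  fixes f :: "'a::real_normed_vector \<Rightarrow> 'b::real_normed_field"
  shows "open S \<Longrightarrow> smooth_on f S \<Longrightarrow> (\<And>x. x \<in> S \<Longrightarrow> f x \<noteq> 0) \<Longrightarrow> smooth_on (\<lambda>x. inverse (f x)) S"
  unfolding smooth_on_def by (blast intro: C_k_on_inverse)

lemma smooth_on_uminus: "open S \<Longrightarrow> smooth_on f S \<Longrightarrow> smooth_on (\<lambda>x. - f x) S"
  by (rule smooth_on_bounded_linear[OF _ bounded_linear_minus[OF bounded_linear_ident]])

lemma smooth_on_diff:
  "open S \<Longrightarrow> smooth_on f S \<Longrightarrow> smooth_on g S \<Longrightarrow> smooth_on (\<lambda>x. f x - g x) S"
  using smooth_on_add[OF _ _ smooth_on_uminus, of S f g] by simp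

lemma smooth_on_cnj: "open S \<Longrightarrow> smooth_on f S \<Longrightarrow> smooth_on (\<lambda>x. cnj (f x)) S"
  by (rule smooth_on_bounded_linear[OF _ bounded_linear_cnj])

lemma smooth_on_of_real:
  fixes f :: "'a::real_normed_vector \<Rightarrow> real"
  shows "open S \<Longrightarrow> smooth_on f S \<Longrightarrow> smooth_on (\<lambda>x. of_real (f x) :: complex) S"
  by (rule smooth_on_bounded_linear[OF _ bounded_linear_of_real])

lemma smooth_on_sum:
  "open S \<Longrightarrow> (\<And>i. i \<in> I \<Longrightarrow> smooth_on (f i) S) \<Longrightarrow> smooth_on (\<lambda>x. \<Sum>i\<in>I. f i x) S"
  by (induction I rule: infinite_finite_induct) (auto intro: smooth_on_const smooth_on_add)

lemma smooth_on_prod: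
  fixes f :: "'i \<Rightarrow> 'a::real_normed_vector \<Rightarrow> 'b::real_normed_field"
  shows "open S \<Longrightarrow> (\<And>i. i \<in> I \<Longrightarrow> smooth_on (f i) S) \<Longrightarrow> smooth_on (\<lambda>x. \<Prod>i\<in>I. f i x) S"
  by (induction I rule: infinite_finite_induct) (auto intro: smooth_on_const smooth_on_mult)

lemma smooth_on_frechet: "smooth_on f S \<Longrightarrow> smooth_on (\<lambda>x. frechet_derivative f (at x) v) S"
  unfolding smooth_on_def by (metis C_k_on.simps(2))

lemma smooth_on_has_derivative:
  "smooth_on f S \<Longrightarrow> x \<in> S \<Longrightarrow> (f has_derivative frechet_derivative f (at x)) (at x)"
  unfolding smooth_on_def by (blast intro: C_k_on_has_derivative)

lemma smooth_on_imp_continuous_on: "smooth_on f S \<Longrightarrow> continuous_on S f"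
  unfolding smooth_on_def by (blast intro: C_k_on_imp_continuous_on)

lemma smooth_on_id: "open S \<Longrightarrow> smooth_on (\<lambda>x. x) S"
  unfolding smooth_on_def
proof
  fix k show "open S \<Longrightarrow> C_k_on k (\<lambda>x. x) S"
    by (cases k) (auto intro: C_k_on_const)
qed

text \<open>
  The derivative is \<open>f' / f\<close>, so the logarithm itself does not recur and no induction is needed.
\<close>

lemma smooth_on_Ln:
  assumes V: "open V" and f: "smooth_on f V" and "\<And>y. y \<in> V \<Longrightarrow> f y \<notin> \<real>\<^sub>\<le>\<^sub>0"
  shows "smooth_on (\<lambda>y. Ln (f y)) V"
  unfolding smooth_on_def
proof
  fix k
  have nz: "f y \<noteq> 0" if "y \<in> V" for y using assms(3)[OF that] by auto
  have "C_k_on (Suc k) (\<lambda>y. Ln (f y)) V"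
  proof (rule C_k_on_SucI[OF V])
    show "((\<lambda>y. Ln (f y)) has_derivative (\<lambda>v. inverse (f y) * frechet_derivative f (at y) v)) (at y)"
      if "y \<in> V" for y
      using has_derivative_compose[OF smooth_on_has_derivative[OF f that]
          has_field_derivative_Ln[OF assms(3)[OF that], unfolded has_field_derivative_def]] by simp
    show "C_k_on k (\<lambda>y. inverse (f y) * frechet_derivative f (at y) v) V" for v
      using smooth_on_mult[OF V smooth_on_inverse[OF V f nz] smooth_on_frechet[OF f]]
      by (simp add: smooth_on_def)
  qed
  then show "C_k_on k (\<lambda>y. Ln (f y)) V" by (rule C_k_on_Suc_imp)
qed

section \<open>Smooth bump functions\<close>

text \<open>
  For \<open>p = 1\<close> this is the standard smooth function \<open>exp (- 1 / t)\<close> that vanishes to infinite order at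
  \<open>0\<close>. The polynomial factor in \<open>1 / t\<close> makes the family closed under differentiation, so that smoothness
  is an induction over all \<open>p\<close> at once.
\<close>

definition flat :: "real poly \<Rightarrow> real \<Rightarrow> real" where
  "flat p t = (if t > 0 then poly p (inverse t) * exp (- inverse t) else 0)"

lemma poly_mult_exp_minus_tendsto_0:
  fixes p :: "real poly"
  shows "((\<lambda>s. poly p s * exp (- s)) \<longlongrightarrow> 0) at_top"
proof -
  have "((\<lambda>s. \<Sum>i\<le>degree p. coeff p i * (s ^ i / exp s)) \<longlongrightarrow> (\<Sum>i\<le>degree p. coeff p i * 0)) at_top"
    by (intro tendsto_intros tendsto_power_div_exp_0)
  then show ?thesis
    by (simp add: poly_altdef sum_distrib_right exp_minus divide_inverse mult.assoc)
qed

text \<open>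
  For \<open>t > 0\<close> substitute \<open>s = 1 / t\<close>, so that \<open>ds/dt = - s\<^sup>2\<close> and \<open>(p(s) exp (- s))' = (p'(s) - p(s)) exp (- s)\<close>.
  At \<open>0\<close> the difference quotient from the right is \<open>s p(s) exp (- s)\<close>, which tends to \<open>0\<close>.
\<close>

lemma flat_has_derivative:
  "(flat p has_field_derivative flat ([:0, 0, 1:] * (p - pderiv p)) t) (at t)"
proof -
  consider "t > 0" | "t < 0" | "t = 0" by linarith
  then show ?thesis
  proof cases
    case 1
    have "((\<lambda>t. poly p (inverse t) * exp (- inverse t)) has_field_derivative
       flat ([:0, 0, 1:] * (p - pderiv p)) t) (at t)"
      using 1 unfolding flat_def
      by (auto intro!: derivative_eq_intros DERIV_chain2[OF poly_DERIV]
          simp: power2_eq_square algebra_simps)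
    then show ?thesis
      by (rule has_field_derivative_transform_within_open[where S = "{0<..}"])
        (use 1 in \<open>auto simp: flat_def\<close>)
  next
    case 2
    have "(flat p has_field_derivative 0) (at t)"
      by (rule has_field_derivative_transform_within_open[OF DERIV_const, of "{..<0}" t 0])
        (use 2 in \<open>auto simp: flat_def\<close>)
    then show ?thesis using 2 by (simp add: flat_def)
  next
    case 3
    have "((\<lambda>h. flat p h / h) \<longlongrightarrow> 0) (at_right 0)"
    proof -
      have "((\<lambda>h. poly ([:0, 1:] * p) (inverse h) * exp (- inverse h)) \<longlongrightarrow> 0) (at_right (0::real))"
        by (rule filterlim_compose[OF poly_mult_exp_minus_tendsto_0 filterlim_inverse_at_top_right])
      then show ?thesis
        by (rule Lim_transform_eventually)
          (auto simp: eventually_at_right_field flat_def field_simps intro!: exI[of _ 1])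
    qed
    moreover have "((\<lambda>h. flat p h / h) \<longlongrightarrow> 0) (at_left 0)"
      by (rule Lim_transform_eventually[of "\<lambda>h. 0"])
        (auto simp: eventually_at_left_field flat_def intro!: exI[of _ "-1"])
    ultimately have "((\<lambda>h. flat p h / h) \<longlongrightarrow> 0) (at 0)"
      by (simp add: filterlim_split_at)
    then show ?thesis
      using 3 by (simp add: DERIV_def flat_def)
  qed
qed

lemma C_k_on_flat:
  assumes "open S" "C_k_on k u S"
  shows "C_k_on k (\<lambda>x. flat p (u x)) S"
  using assms(2)
proof (induction k arbitrary: p)
  case 0
  have "continuous_on UNIV (flat p)"
    by (meson DERIV_continuous continuous_at_imp_continuous_on flat_has_derivative)
  with 0 show ?case by (auto intro: continuous_on_compose2)
next
  case (Suc k)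
  show ?case
  proof (rule C_k_on_SucI[OF \<open>open S\<close> DERIV_compose_FDERIV[OF flat_has_derivative
          C_k_on_has_derivative[OF Suc.prems]]])
    fix v
    show "C_k_on k (\<lambda>x. frechet_derivative u (at x) v * flat ([:0, 0, 1:] * (p - pderiv p)) (u x)) S"
      by (intro C_k_on_bounded_bilinear[OF \<open>open S\<close> bounded_bilinear_mult] Suc.IH
          C_k_on_Suc_imp[OF Suc.prems]) (use Suc.prems in simp)
  qed
qed

definition bump :: "'a::euclidean_space \<Rightarrow> real \<Rightarrow> 'a \<Rightarrow> real" where
  "bump a r x = flat 1 (r\<^sup>2 - (x - a) \<bullet> (x - a))"

lemma smooth_on_bump: "smooth_on (bump a r) UNIV"
proof -
  have id: "C_k_on k (\<lambda>x. x - a) UNIV" for k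
    using smooth_on_diff[OF open_UNIV smooth_on_id[OF open_UNIV] smooth_on_const[OF open_UNIV], of a]
    by (simp add: smooth_on_def)
  have "smooth_on (\<lambda>x. (x - a) \<bullet> (x - a)) UNIV"
    unfolding smooth_on_def by (intro allI C_k_on_bounded_bilinear[OF open_UNIV bounded_bilinear_inner] id)
  then have "smooth_on (\<lambda>x. r\<^sup>2 - (x - a) \<bullet> (x - a)) UNIV"
    by (intro smooth_on_diff smooth_on_const open_UNIV)
  then show ?thesis
    unfolding smooth_on_def bump_def[abs_def] by (intro allI C_k_on_flat open_UNIV) blast
qed

lemma bump_nonneg: "0 \<le> bump a r x"
  by (simp add: bump_def flat_def)

lemma bump_pos_iff:
  assumes "r > 0" shows "0 < bump a r x \<longleftrightarrow> x \<in> ball a r"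
proof -
  have "norm (x - a) < r \<longleftrightarrow> (norm (x - a))\<^sup>2 < r\<^sup>2"
    using assms by (intro iffI power_strict_mono) (auto intro: power2_less_imp_less)
  then show ?thesis
    by (simp add: bump_def flat_def dot_square_norm dist_norm norm_minus_commute)
qed

lemma bump_eq_0: assumes "r > 0" "x \<notin> ball a r" shows "bump a r x = 0"
  using bump_pos_iff[OF assms(1)] bump_nonneg assms(2) by (metis less_eq_real_def)

section \<open>Symmetry of second derivatives\<close>

lemma directional_derivative:
  fixes f :: "'a::real_normed_vector \<Rightarrow> 'b::real_normed_vector"
  assumes "(f has_derivative f') (at (y + a *\<^sub>R v))"
  shows "((\<lambda>a. f (y + a *\<^sub>R v)) has_vector_derivative f' v) (at a)"
proof -
  have "((\<lambda>a. y + a *\<^sub>R v) has_vector_derivative v) (at a)"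
    by (auto intro!: derivative_eq_intros)
  then have "((f \<circ> (\<lambda>a. y + a *\<^sub>R v)) has_vector_derivative f' v) (at a)"
    by (rule vector_derivative_diff_chain_within) (use assms has_derivative_at_withinI in blast)
  then show ?thesis by (simp add: o_def)
qed

text \<open>
  The mean value theorem is applied twice: first to
  \<open>a \<mapsto> f (x + t w + a v) - f (x + a v)\<close>, then to the \<open>v\<close>-derivative of \<open>f\<close> along the direction \<open>w\<close>.
  The left-hand side is symmetric in \<open>v\<close> and \<open>w\<close>, which is what makes the mixed derivatives agree in
  the limit.
\<close>

lemma second_difference_mvt:
  fixes f :: "'a::real_normed_vector \<Rightarrow> real"
  assumes "C_k_on 2 f (ball x e)" "0 < t" "t * (norm v + norm w) < e"
  shows "\<exists>\<xi>\<in>ball x e. f (x + t *\<^sub>R v + t *\<^sub>R w) - f (x + t *\<^sub>R v) - f (x + t *\<^sub>R w) + f x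
     = t\<^sup>2 * frechet_derivative (\<lambda>y. frechet_derivative f (at y) v) (at \<xi>) w"
proof -
  define D where "D y = frechet_derivative f (at y) v" for y
  define D2 where "D2 y = frechet_derivative D (at y) w" for y
  have D: "(f has_derivative frechet_derivative f (at y)) (at y)"
    and D2: "(D has_derivative frechet_derivative D (at y)) (at y)" if "y \<in> ball x e" for y
    using assms(1) that unfolding D_def[abs_def]
    by (auto simp: frechet_derivative_works[symmetric] numeral_2_eq_2)
  have inball: "x + a *\<^sub>R v + b *\<^sub>R w \<in> ball x e" if "0 \<le> a" "a \<le> t" "0 \<le> b" "b \<le> t" for a b
  proof -
    have "norm (a *\<^sub>R v + b *\<^sub>R w) \<le> a * norm v + b * norm w"
      using that by (intro norm_triangle_le) simp
    also have "\<dots> \<le> t * norm v + t * norm w"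
      using that by (intro add_mono mult_right_mono) auto
    finally have "norm (a *\<^sub>R v + b *\<^sub>R w) < e"
      using assms(3) by (simp add: algebra_simps)
    moreover have "dist x (x + a *\<^sub>R v + b *\<^sub>R w) = norm (a *\<^sub>R v + b *\<^sub>R w)"
      by (metis add.assoc add_diff_cancel_left' dist_commute dist_norm)
    ultimately show ?thesis by simp
  qed
  have inball0: "x + a *\<^sub>R v \<in> ball x e" if "0 \<le> a" "a \<le> t" for a
    using inball[of a 0] that assms(2) by simp
  define \<phi> where "\<phi> a = f ((x + t *\<^sub>R w) + a *\<^sub>R v) - f (x + a *\<^sub>R v)" for a
  have "\<exists>a. 0 < a \<and> a < t \<and> \<phi> t - \<phi> 0 = (t - 0) * (D ((x + t *\<^sub>R w) + a *\<^sub>R v) - D (x + a *\<^sub>R v))"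
  proof (rule MVT2[OF \<open>0 < t\<close>])
    fix a assume a: "0 \<le> a" "a \<le> t"
    have "x + t *\<^sub>R w + a *\<^sub>R v \<in> ball x e"
      using inball[of a t] a assms(2) by (simp add: ac_simps)
    from directional_derivative[OF D[OF this]] directional_derivative[OF D[OF inball0[OF a]]]
    show "(\<phi> has_real_derivative D (x + t *\<^sub>R w + a *\<^sub>R v) - D (x + a *\<^sub>R v)) (at a)"
      unfolding \<phi>_def D_def
      by (intro DERIV_diff) (simp_all add: has_real_derivative_iff_has_vector_derivative)
  qed
  then obtain a where a: "0 < a" "a < t"
    and \<phi>: "\<phi> t - \<phi> 0 = t * (D (x + a *\<^sub>R v + t *\<^sub>R w) - D (x + a *\<^sub>R v))"
    by (auto simp: ac_simps)
  have "\<exists>b. 0 < b \<and> b < t \<and> D ((x + a *\<^sub>R v) + t *\<^sub>R w) - D ((x + a *\<^sub>R v) + 0 *\<^sub>R w)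
      = (t - 0) * D2 ((x + a *\<^sub>R v) + b *\<^sub>R w)"
  proof (rule MVT2[OF \<open>0 < t\<close>])
    fix b assume b: "0 \<le> b" "b \<le> t"
    have "x + a *\<^sub>R v + b *\<^sub>R w \<in> ball x e" using inball a b by simp
    from directional_derivative[OF D2[OF this]]
    show "((\<lambda>b. D (x + a *\<^sub>R v + b *\<^sub>R w)) has_real_derivative D2 (x + a *\<^sub>R v + b *\<^sub>R w)) (at b)"
      unfolding D2_def by (simp add: has_real_derivative_iff_has_vector_derivative)
  qed
  then obtain b where b: "0 < b" "b < t"
    and DD: "D (x + a *\<^sub>R v + t *\<^sub>R w) - D (x + a *\<^sub>R v) = t * D2 (x + a *\<^sub>R v + b *\<^sub>R w)"
    by auto
  have "f (x + t *\<^sub>R v + t *\<^sub>R w) - f (x + t *\<^sub>R v) - f (x + t *\<^sub>R w) + f x = \<phi> t - \<phi> 0"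
    by (simp add: \<phi>_def ac_simps)
  also have "\<dots> = t\<^sup>2 * D2 (x + a *\<^sub>R v + b *\<^sub>R w)"
    by (simp add: \<phi> DD power2_eq_square)
  finally show ?thesis
    using inball[of a b] a b unfolding D2_def D_def[abs_def] by (intro bexI) auto
qed

lemma symmetric_second_derivative_real:
  fixes f :: "'a::real_normed_vector \<Rightarrow> real"
  assumes "open S" "C_k_on 2 f S" "x \<in> S"
  shows "frechet_derivative (\<lambda>y. frechet_derivative f (at y) v) (at x) w
       = frechet_derivative (\<lambda>y. frechet_derivative f (at y) w) (at x) v"
proof -
  define A where "A v w y = frechet_derivative (\<lambda>y. frechet_derivative f (at y) v) (at y) w" for v w y
  have cont: "continuous (at x) (A v w)" for v w
    using assms unfolding A_def numeral_2_eq_2 by (simp add: continuous_on_eq_continuous_at)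
  have bound: "dist (A v w x) (A w v x) \<le> 2 * \<epsilon>" if "\<epsilon> > 0" for \<epsilon>
  proof -
    obtain d1 d2 where d: "d1 > 0" "\<And>y. dist y x < d1 \<Longrightarrow> dist (A v w y) (A v w x) < \<epsilon>"
      "d2 > 0" "\<And>y. dist y x < d2 \<Longrightarrow> dist (A w v y) (A w v x) < \<epsilon>"
      using cont[of v w] cont[of w v] \<open>\<epsilon> > 0\<close> unfolding continuous_at_eps_delta dist_norm by metis
    obtain r where r: "r > 0" "ball x r \<subseteq> S"
      using assms(1,3) by (auto simp: open_contains_ball)
    define e where "e = min r (min d1 d2)"
    have e: "e > 0" "e \<le> d1" "e \<le> d2" "ball x e \<subseteq> S"
      using d r by (auto simp: e_def)
    have C2: "C_k_on 2 f (ball x e)"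
      by (rule C_k_on_subset[OF assms(2) e(4)])
    define t where "t = e / (2 * (1 + norm v + norm w))"
    have pos: "1 + norm v + norm w > 0" by (simp add: add_pos_nonneg)
    then have t: "t > 0" using e by (simp add: t_def)
    have "s < 2 * (1 + s)" if "0 \<le> s" for s :: real
      using that by simp
    from this[of "norm v + norm w"] have "norm v + norm w < 2 * (1 + norm v + norm w)"
      by (simp add: add.assoc)
    then have "t * (norm v + norm w) < t * (2 * (1 + norm v + norm w))"
      by (rule mult_strict_left_mono[OF _ t])
    also have "\<dots> = e" using pos unfolding t_def by (simp del: distrib_left_numeral)
    finally have te: "t * (norm v + norm w) < e" .
    obtain p where p: "p \<in> ball x e"
      "f (x + t *\<^sub>R v + t *\<^sub>R w) - f (x + t *\<^sub>R v) - f (x + t *\<^sub>R w) + f x = t\<^sup>2 * A v w p"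
      using second_difference_mvt[OF C2 t te] unfolding A_def by blast
    obtain q where q: "q \<in> ball x e"
      "f (x + t *\<^sub>R w + t *\<^sub>R v) - f (x + t *\<^sub>R w) - f (x + t *\<^sub>R v) + f x = t\<^sup>2 * A w v q"
      using second_difference_mvt[OF C2 t, of w v] te unfolding A_def by (auto simp: add.commute)
    have "t\<^sup>2 * A v w p = t\<^sup>2 * A w v q"
      using p(2) q(2) by (simp add: algebra_simps)
    then have "A v w p = A w v q" using t by simp
    moreover have "dist (A v w p) (A v w x) < \<epsilon>" "dist (A w v q) (A w v x) < \<epsilon>"
      using p(1) q(1) e by (auto intro!: d simp: dist_commute)
    ultimately show ?thesis
      using dist_triangle[of "A v w x" "A w v x" "A v w p"] by (simp add: dist_commute)
  qed
  have "dist (A v w x) (A w v x) \<le> 0"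
  proof (rule field_le_epsilon)
    fix e :: real assume "e > 0"
    then show "dist (A v w x) (A w v x) \<le> 0 + e"
      using bound[of "e / 2"] by simp
  qed
  then show ?thesis by (simp add: A_def)
qed

lemma frechet_bounded_linear:
  assumes "bounded_linear L" "f differentiable (at x)"
  shows "frechet_derivative (\<lambda>y. L (f y)) (at x) v = L (frechet_derivative f (at x) v)"
proof -
  have "((\<lambda>y. L (f y)) has_derivative (\<lambda>v. L (frechet_derivative f (at x) v))) (at x)"
    using bounded_linear.has_derivative[OF assms(1)] assms(2) frechet_derivative_works by blast
  from frechet_derivative_at[OF this] show ?thesis by metis
qed

lemma frechet_eq_on_open:
  assumes "open S" "x \<in> S" "\<And>y. y \<in> S \<Longrightarrow> f y = g y"
  shows "frechet_derivative f (at x) = frechet_derivative g (at x)"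
proof -
  have "(f has_derivative D) (at x) \<longleftrightarrow> (g has_derivative D) (at x)" for D
    using has_derivative_transform_within_open[OF _ assms(1,2)] assms(3) by metis
  then show ?thesis by (simp add: frechet_derivative_def)
qed

lemma frechet_derivative_eq_0_off_compact:
  fixes f :: "'a::real_normed_vector \<Rightarrow> 'b::real_normed_vector"
  assumes "compact K" "\<And>x. x \<notin> K \<Longrightarrow> f x = 0" "x \<notin> K"
  shows "frechet_derivative f (at x) v = 0"
proof -
  have "frechet_derivative f (at x) = frechet_derivative (\<lambda>x. 0) (at x)"
    by (rule frechet_eq_on_open[of "- K"])
      (use assms in \<open>auto simp: compact_imp_closed open_Compl\<close>)
  then show ?thesis by simp
qed

text \<open>
  The mean value theorem needs real values, so a complex function is treated by its real and
  imaginary part.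
\<close>

lemma symmetric_second_derivative:
  fixes f :: "'a::real_normed_vector \<Rightarrow> complex"
  assumes "open S" "smooth_on f S" "x \<in> S"
  shows "frechet_derivative (\<lambda>y. frechet_derivative f (at y) v) (at x) w
       = frechet_derivative (\<lambda>y. frechet_derivative f (at y) w) (at x) v"
proof -
  have L: "L (frechet_derivative (\<lambda>y. frechet_derivative f (at y) v) (at x) w)
       = L (frechet_derivative (\<lambda>y. frechet_derivative f (at y) w) (at x) v)"
    if L: "bounded_linear L" for L :: "complex \<Rightarrow> real"
  proof -
    have eq: "frechet_derivative (\<lambda>y. frechet_derivative (\<lambda>z. L (f z)) (at y) v) (at x) w
       = L (frechet_derivative (\<lambda>y. frechet_derivative f (at y) v) (at x) w)" for v w
    proof -
      have diff: "f differentiable (at y)" if "y \<in> S" for y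
        using smooth_on_has_derivative[OF assms(2) that] by (auto simp: differentiable_def)
      have "frechet_derivative (\<lambda>y. frechet_derivative (\<lambda>z. L (f z)) (at y) v) (at x)
          = frechet_derivative (\<lambda>y. L (frechet_derivative f (at y) v)) (at x)"
        by (rule frechet_eq_on_open[OF assms(1,3)]) (rule frechet_bounded_linear[OF L diff])
      moreover have "(\<lambda>y. frechet_derivative f (at y) v) differentiable (at x)"
        using smooth_on_has_derivative[OF smooth_on_frechet[OF assms(2)] assms(3)]
        by (auto simp: differentiable_def)
      ultimately show ?thesis
        by (simp add: frechet_bounded_linear[OF L])
    qed
    have "C_k_on 2 (\<lambda>z. L (f z)) S"
      using smooth_on_bounded_linear[OF assms(1) L assms(2)] by (simp add: smooth_on_def)
    from symmetric_second_derivative_real[OF assms(1) this assms(3)]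
    show ?thesis by (simp add: eq)
  qed
  show ?thesis
    by (rule complex_eqI) (intro L bounded_linear_Re bounded_linear_Im)+
qed

section \<open>Integration by parts\<close>

text \<open>
  The integral of \<open>F (x + t v) - F x\<close> vanishes by translation invariance. Divide by \<open>t\<close> and let \<open>t\<close>
  tend to \<open>0\<close>: by the mean value theorem the difference quotients are bounded by the maximum of the
  derivative, and they live on a fixed compact set, so dominated convergence applies.
\<close>

lemma integral_frechet_derivative_eq_0:
  fixes F :: "'a::euclidean_space \<Rightarrow> complex"
  assumes C1: "C_k_on 1 F UNIV" and K: "compact K" and supp: "\<And>x. x \<notin> K \<Longrightarrow> F x = 0"
  shows "(LINT x|lborel. frechet_derivative F (at x) v) = 0"
proof -
  define D where "D x = frechet_derivative F (at x) v" for x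
  have der: "(F has_derivative frechet_derivative F (at x)) (at x)" for x
    using C1 by (simp add: frechet_derivative_works)
  have contD: "continuous_on UNIV D" using C1 by (simp add: D_def[abs_def])
  have contF: "continuous_on UNIV F" by (rule C_k_on_imp_continuous_on[OF C1])
  have D0: "D x = 0" if "x \<notin> K" for x
    unfolding D_def by (rule frechet_derivative_eq_0_off_compact[OF K supp that])
  have "compact (D ` K)"
    by (rule compact_continuous_image[OF continuous_on_subset[OF contD] K]) simp
  then obtain B where B: "\<And>x. x \<in> K \<Longrightarrow> norm (D x) \<le> B"
    by (metis bounded_iff compact_imp_bounded imageI)
  define C where "C = max B 0"
  have C: "norm (D x) \<le> C" for x
    using B[of x] D0[of x] by (cases "x \<in> K") (auto simp: C_def)
  have mvt: "norm (F (x + t *\<^sub>R v) - F x) \<le> t * C" if "t > 0" for x t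
  proof -
    have vd: "((\<lambda>a. F (x + a *\<^sub>R v)) has_vector_derivative D (x + a *\<^sub>R v)) (at a)" for a
      unfolding D_def by (rule directional_derivative[OF der])
    have "\<exists>a\<in>{0<..<t}. norm (F (x + t *\<^sub>R v) - F (x + 0 *\<^sub>R v)) \<le> norm ((t - 0) *\<^sub>R D (x + a *\<^sub>R v))"
    proof (rule mvt_general[OF that])
      show "continuous_on {0..t} (\<lambda>a. F (x + a *\<^sub>R v))"
        by (intro continuous_on_compose2[OF contF] continuous_intros) auto
    qed (use vd in \<open>simp add: has_vector_derivative_def\<close>)
    then obtain a where "norm (F (x + t *\<^sub>R v) - F x) \<le> t * norm (D (x + a *\<^sub>R v))"
      using that by auto
    also have "\<dots> \<le> t * C" using C that by (intro mult_left_mono) auto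
    finally show ?thesis .
  qed
  \<comment> \<open>\<open>K'\<close> contains the supports of all difference quotients with steps in \<open>[0, 1]\<close>.\<close>
  define K' where "K' = (\<lambda>(x, t). x - t *\<^sub>R v) ` (K \<times> {0..1::real})"
  have K': "compact K'" unfolding K'_def
    by (intro compact_continuous_image compact_Times K compact_Icc)
      (auto intro!: continuous_intros simp: case_prod_unfold)
  define \<epsilon> where "\<epsilon> n = inverse (real (Suc n))" for n
  have \<epsilon>: "0 < \<epsilon> n" "\<epsilon> n \<le> 1" for n by (auto simp: \<epsilon>_def inverse_eq_divide)
  define s where "s n x = (F (x + \<epsilon> n *\<^sub>R v) - F x) /\<^sub>R \<epsilon> n" for n x
  have intF: "integrable lborel F"
  proof -
    have "integrable lborel (\<lambda>x. indicator K x *\<^sub>R F x)"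
      by (rule borel_integrable_compact[OF K continuous_on_subset[OF contF]]) simp
    moreover have "(\<lambda>x. indicator K x *\<^sub>R F x) = F"
      using supp by (auto simp: fun_eq_iff indicator_def)
    ultimately show ?thesis by simp
  qed
  have Fm: "F \<in> borel_measurable borel" by (rule borel_measurable_continuous_onI[OF contF])
  have shift: "integrable lborel (\<lambda>x. F (x + a))" "(LINT x|lborel. F (x + a)) = (LINT x|lborel. F x)" for a
  proof -
    have "integrable (distr lborel borel ((+) a)) F" using intF by (simp add: lborel_distr_plus)
    then show "integrable lborel (\<lambda>x. F (x + a))"
      by (subst (asm) integrable_distr_eq) (auto simp: Fm add.commute)
    have "(LINT x|lborel. F x) = (LINT x|distr lborel borel ((+) a). F x)"
      by (simp add: lborel_distr_plus)
    also have "\<dots> = (LINT x|lborel. F (a + x))"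
      by (rule integral_distr) (auto simp: Fm)
    finally show "(LINT x|lborel. F (x + a)) = (LINT x|lborel. F x)" by (simp add: add.commute)
  qed
  have s0: "(LINT x|lborel. s n x) = 0" for n
    unfolding s_def using shift[of "\<epsilon> n *\<^sub>R v"] intF by simp
  have "(\<lambda>n. LINT x|lborel. s n x) \<longlonglongrightarrow> (LINT x|lborel. D x)"
  proof (rule integral_dominated_convergence[where w = "\<lambda>x. indicator K' x *\<^sub>R C"])
    show "D \<in> borel_measurable lborel"
      using borel_measurable_continuous_onI[OF contD] by simp
    show "s n \<in> borel_measurable lborel" for n
      unfolding s_def by (intro borel_measurable_scaleR borel_measurable_diff borel_measurable_const
          borel_measurable_integrable shift intF)
    show "integrable lborel (\<lambda>x. indicator K' x *\<^sub>R C)"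
      by (rule borel_integrable_compact[OF K']) simp
    show "AE x in lborel. (\<lambda>n. s n x) \<longlonglongrightarrow> D x"
    proof (rule AE_I2)
      fix x
      have "((\<lambda>a. F (x + a *\<^sub>R v)) has_vector_derivative D x) (at 0)"
        using directional_derivative[of F _ x 0 v] der[of x] by (simp add: D_def)
      then have "((\<lambda>h. norm (F (x + h *\<^sub>R v) - F x - h *\<^sub>R D x) / norm h) \<longlongrightarrow> 0) (at 0)"
        by (simp add: has_vector_derivative_def has_derivative_at)
      then have "((\<lambda>h. norm ((F (x + h *\<^sub>R v) - F x) /\<^sub>R h - D x)) \<longlongrightarrow> 0) (at 0)"
      proof (rule Lim_transform_eventually)
        have "norm (F (x + h *\<^sub>R v) - F x - h *\<^sub>R D x) / norm h
            = norm ((F (x + h *\<^sub>R v) - F x) /\<^sub>R h - D x)" if "h \<noteq> 0" for h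
        proof -
          have "(F (x + h *\<^sub>R v) - F x) /\<^sub>R h - D x = (F (x + h *\<^sub>R v) - F x - h *\<^sub>R D x) /\<^sub>R h"
            using that by (simp add: scaleR_diff_right)
          then show ?thesis by (simp add: divide_inverse_commute)
        qed
        then show "\<forall>\<^sub>F h in at 0. norm (F (x + h *\<^sub>R v) - F x - h *\<^sub>R D x) / norm h
            = norm ((F (x + h *\<^sub>R v) - F x) /\<^sub>R h - D x)"
          by (simp add: eventually_at_filter)
      qed
      then have "((\<lambda>h. (F (x + h *\<^sub>R v) - F x) /\<^sub>R h) \<longlongrightarrow> D x) (at 0)"
        by (simp add: tendsto_norm_zero_iff LIM_zero_iff)
      moreover have "filterlim \<epsilon> (at 0) sequentially"
        unfolding filterlim_at using \<epsilon>(1) LIMSEQ_inverse_real_of_nat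
        by (auto simp: \<epsilon>_def[abs_def] less_imp_neq[symmetric])
      ultimately show "(\<lambda>n. s n x) \<longlonglongrightarrow> D x"
        unfolding s_def by (rule filterlim_compose)
    qed
    show "AE x in lborel. norm (s n x) \<le> indicator K' x *\<^sub>R C" for n
    proof (rule AE_I2)
      fix x
      have "norm (s n x) \<le> C"
        using mvt[OF \<epsilon>(1), of x n] \<epsilon>(1)[of n]
        by (simp add: s_def divide_inverse_commute[symmetric] pos_divide_le_eq mult.commute)
      moreover have "s n x = 0" if "x \<notin> K'"
      proof -
        have "x \<notin> K"
        proof
          assume "x \<in> K"
          then have "(\<lambda>(x, t). x - t *\<^sub>R v) (x, 0) \<in> K'"
            unfolding K'_def by (intro imageI) auto
          with that show False by simp
        qed
        moreover have "x + \<epsilon> n *\<^sub>R v \<notin> K"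
        proof
          assume "x + \<epsilon> n *\<^sub>R v \<in> K"
          then have "(\<lambda>(x, t). x - t *\<^sub>R v) (x + \<epsilon> n *\<^sub>R v, \<epsilon> n) \<in> K'"
            unfolding K'_def using \<epsilon>[of n] by (intro imageI) auto
          with that show False by simp
        qed
        ultimately show ?thesis by (simp add: s_def supp)
      qed
      ultimately show "norm (s n x) \<le> indicator K' x *\<^sub>R C" by (auto simp: indicator_def)
    qed
  qed
  then show ?thesis
    by (simp add: s0 D_def LIMSEQ_const_iff)
qed

lemma set_integrable_compact_support:
  fixes u \<psi> :: "'a::euclidean_space \<Rightarrow> complex"
  assumes "continuous_on V u" "continuous_on V \<psi>" "compact K" "K \<subseteq> V" "\<And>x. x \<notin> K \<Longrightarrow> \<psi> x = 0"
  shows "set_integrable lborel V (\<lambda>x. u x * \<psi> x)"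
proof -
  have "integrable lborel (\<lambda>x. indicator K x *\<^sub>R (u x * \<psi> x))"
    by (rule borel_integrable_compact[OF assms(3)])
      (intro continuous_on_mult continuous_on_subset[OF _ assms(4)] assms)
  moreover have "indicator K x *\<^sub>R (u x * \<psi> x) = indicator V x *\<^sub>R (u x * \<psi> x)" for x
    using assms(4,5) by (auto simp: indicator_def)
  ultimately show ?thesis by (simp add: set_integrable_def)
qed

text \<open>
  The function \<open>A\<close> lives on \<open>V\<close> only; since \<open>\<psi>\<close> vanishes off a compact subset of \<open>V\<close>, the product
  \<open>A \<psi>\<close> extended by \<open>0\<close> is continuously differentiable on the whole space.
\<close>

lemma integral_by_parts_frechet:
  fixes A \<psi> :: "'a::euclidean_space \<Rightarrow> complex"
  assumes V: "open V" and A: "smooth_on A V" and \<psi>: "smooth_on \<psi> UNIV"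
    and K: "compact K" "K \<subseteq> V" "\<And>x. x \<notin> K \<Longrightarrow> \<psi> x = 0"
  shows "(LINT x:V|lborel. A x * frechet_derivative \<psi> (at x) v)
       = - (LINT x:V|lborel. frechet_derivative A (at x) v * \<psi> x)"
proof -
  define F where "F x = (if x \<in> V then A x * \<psi> x else 0)" for x
  have \<psi>V: "smooth_on \<psi> V" using \<psi> by (rule smooth_on_subset) simp
  have nK: "open (- K)" using K(1) by (simp add: compact_imp_closed open_Compl)
  have "C_k_on 1 F (V \<union> - K)"
  proof (rule C_k_on_Un[OF V nK])
    show "C_k_on 1 F V"
      by (rule C_k_on_cong[OF V, of "\<lambda>x. A x * \<psi> x"])
        (use smooth_on_mult[OF V A \<psi>V] in \<open>auto simp: F_def smooth_on_def\<close>)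
    show "C_k_on 1 F (- K)"
      by (rule C_k_on_cong[OF nK _ C_k_on_const[OF nK]]) (auto simp: F_def K)
  qed
  moreover have "V \<union> - K = UNIV" using K(2) by auto
  ultimately have "C_k_on 1 F UNIV" by simp
  then have "(LINT x|lborel. frechet_derivative F (at x) v) = 0"
    by (rule integral_frechet_derivative_eq_0[OF _ K(1)]) (auto simp: F_def K)
  moreover have d\<psi>0: "frechet_derivative \<psi> (at x) v = 0" if "x \<notin> K" for x
    by (rule frechet_derivative_eq_0_off_compact[OF K(1,3) that])
  moreover have "frechet_derivative F (at x) v
     = indicator V x *\<^sub>R (A x * frechet_derivative \<psi> (at x) v + frechet_derivative A (at x) v * \<psi> x)" for x
  proof (cases "x \<in> V")
    case True
    have "frechet_derivative F (at x) = frechet_derivative (\<lambda>x. A x * \<psi> x) (at x)"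
      by (rule frechet_eq_on_open[OF V True]) (simp add: F_def)
    also have "\<dots> = (\<lambda>v. A x * frechet_derivative \<psi> (at x) v + frechet_derivative A (at x) v * \<psi> x)"
      by (rule frechet_derivative_at[symmetric], rule has_derivative_mult)
        (use smooth_on_has_derivative[OF _ True] A \<psi>V in auto)
    finally show ?thesis using True by simp
  next
    case False
    then have "x \<in> - K" using K(2) by auto
    then have "frechet_derivative F (at x) = frechet_derivative (\<lambda>x. 0) (at x)"
      by (intro frechet_eq_on_open[OF nK]) (auto simp: F_def K)
    then show ?thesis using False by simp
  qed
  ultimately have "(LINT x:V|lborel. A x * frechet_derivative \<psi> (at x) v + frechet_derivative A (at x) v * \<psi> x) = 0"
    by (simp add: set_lebesgue_integral_def)
  moreover have "set_integrable lborel V (\<lambda>x. A x * frechet_derivative \<psi> (at x) v)"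
    by (rule set_integrable_compact_support[OF _ _ K(1,2)])
      (use A \<psi>V smooth_on_frechet smooth_on_imp_continuous_on d\<psi>0 in blast)+
  moreover have "set_integrable lborel V (\<lambda>x. frechet_derivative A (at x) v * \<psi> x)"
    by (rule set_integrable_compact_support[OF _ _ K])
      (use A \<psi>V smooth_on_frechet smooth_on_imp_continuous_on in blast)+
  ultimately show ?thesis
    by (simp add: set_integral_add(2) eq_neg_iff_add_eq_0)
qed

text \<open>
  The fundamental lemma of the calculus of variations. If \<open>u a\<close> is not \<open>0\<close>, then
  \<open>Re (u x * cnj (u a))\<close> is positive near \<open>a\<close>, and testing \<open>u\<close> with \<open>cnj (u a)\<close> times a bump function gives
  a positive integral.
\<close>

lemma eq_0_if_weakly_0:
  fixes u :: "'a::euclidean_space \<Rightarrow> complex"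
  assumes V: "open V" and u: "continuous_on V u"
    and weak: "\<And>\<psi> K. smooth_on \<psi> UNIV \<Longrightarrow> compact K \<Longrightarrow> K \<subseteq> V \<Longrightarrow> (\<And>x. x \<notin> K \<Longrightarrow> \<psi> x = 0) \<Longrightarrow>
       (LINT x:V|lborel. u x * \<psi> x) = 0"
    and "a \<in> V"
  shows "u a = 0"
proof (rule ccontr)
  assume nz: "u a \<noteq> 0"
  define w where "w x = Re (u x * cnj (u a))" for x
  have contw: "continuous_on V w"
    unfolding w_def by (intro continuous_intros u)
  have "w a > 0" using nz by (simp add: w_def complex_mult_cnj sum_power2_gt_zero_iff complex_eq_iff)
  then have "open (w -` {0<..} \<inter> V)" "a \<in> w -` {0<..} \<inter> V"
    using continuous_open_preimage[OF contw V] \<open>a \<in> V\<close> by (auto simp: Int_commute)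
  then obtain r where r: "r > 0" "cball a r \<subseteq> w -` {0<..} \<inter> V"
    using open_contains_cball by blast
  define \<psi> where "\<psi> x = cnj (u a) * of_real (bump a r x)" for x
  have \<psi>0: "\<psi> x = 0" if "x \<notin> cball a r" for x
    using bump_eq_0[OF r(1), of x a] that by (simp add: \<psi>_def)
  have \<psi>: "smooth_on \<psi> UNIV"
    unfolding \<psi>_def by (intro smooth_on_mult smooth_on_const smooth_on_of_real smooth_on_bump open_UNIV)
  have int0: "(LINT x:V|lborel. u x * \<psi> x) = 0"
    by (rule weak[OF \<psi> compact_cball]) (use r \<psi>0 in auto)
  have int: "set_integrable lborel V (\<lambda>x. u x * \<psi> x)"
    by (rule set_integrable_compact_support[OF u _ compact_cball _ \<psi>0])
      (use r smooth_on_imp_continuous_on[OF \<psi>] in \<open>auto intro: continuous_on_subset\<close>)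
  define h where "h x = Re (indicator V x *\<^sub>R (u x * \<psi> x))" for x
  have h: "h x = indicator V x * (w x * bump a r x)" for x
    by (simp add: h_def w_def \<psi>_def mult.assoc[symmetric])
  have h_pos: "h x > 0" if "x \<in> ball a r" for x
  proof -
    have "x \<in> cball a r" using that by simp
    then have "w x > 0" "x \<in> V" using r(2) by auto
    then show ?thesis using that bump_pos_iff[OF r(1), of a x] by (simp add: h)
  qed
  have h_nonneg: "h x \<ge> 0" for x
    using h_pos[of x] bump_eq_0[OF r(1), of x a] by (cases "x \<in> ball a r") (auto simp: h)
  have inth: "integrable lborel h"
    unfolding h_def using int unfolding set_integrable_def by (rule integrable_Re)
  have "(LINT x|lborel. h x) = Re (LINT x:V|lborel. u x * \<psi> x)"
    unfolding h_def set_lebesgue_integral_def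
    by (rule integral_Re) (use int in \<open>simp add: set_integrable_def\<close>)
  then have "AE x in lborel. h x = 0"
    using integral_nonneg_eq_0_iff_AE[OF inth] h_nonneg int0 by simp
  then have "AE x in lborel. x \<notin> ball a r"
    by (rule AE_mp) (use h_pos in \<open>fastforce intro!: AE_I2\<close>)
  then have "ball a r \<in> null_sets lborel"
    by (simp add: AE_iff_null_sets)
  then have "negligible (ball a r)"
    using negligible_iff_null_sets null_sets_completionI by blast
  then show False
    using open_not_negligible[of "ball a r"] r(1) by simp
qed

section \<open>Wirtinger derivatives\<close>

text \<open>
  The cases \<open>c = - \<i>\<close> and \<open>c = \<i>\<close> are the operators \<open>dz\<close> and \<open>dzbar\<close>. Their rules are the same
  and are proved for both together.
\<close>

definition wirtinger :: "complex \<Rightarrow> 'n \<Rightarrow> (complex^'n \<Rightarrow> complex) \<Rightarrow> complex^'n \<Rightarrow> complex" where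
  "wirtinger c i f x = (frechet_derivative f (at x) (axis i 1)
                + c * frechet_derivative f (at x) (axis i \<i>)) / 2"

lemma dz_eq_wirtinger: "dz i f x = wirtinger (- \<i>) i f x"
  by (simp add: dz_def wirtinger_def)

lemma dzbar_eq_wirtinger: "dzbar i f x = wirtinger \<i> i f x"
  by (simp add: dzbar_def wirtinger_def)

context
  fixes V :: "(complex^'n::finite) set" and x :: "complex^'n"
  assumes V: "open V" and x: "x \<in> V"
begin

lemma wirtinger_cong: "(\<And>y. y \<in> V \<Longrightarrow> f y = g y) \<Longrightarrow> wirtinger c i f x = wirtinger c i g x"
  unfolding wirtinger_def by (simp add: frechet_eq_on_open[OF V x, of f g])

text \<open>
  The factor \<open>h\<close> records how \<open>L\<close> treats complex scalars: \<open>h = cnj\<close> for conjugation, which exchanges the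
  two Wirtinger derivatives, and the identity for a complex linear \<open>L\<close>.
\<close>

lemma wirtinger_bounded_linear:
  assumes "bounded_linear L" "\<And>a z. L (a * z) = h a * L z" "smooth_on f V"
  shows "L (wirtinger c i f x) = wirtinger (h c) i (\<lambda>y. L (f y)) x"
proof -
  interpret L: bounded_linear L by fact
  have "L (wirtinger c i f x) = L ((1 / 2 :: real) *\<^sub>R (frechet_derivative f (at x) (axis i 1)
                + c * frechet_derivative f (at x) (axis i \<i>)))"
    by (simp add: wirtinger_def scaleR_conv_of_real)
  also have "\<dots> = (1 / 2 :: real) *\<^sub>R (L (frechet_derivative f (at x) (axis i 1))
                + h c * L (frechet_derivative f (at x) (axis i \<i>)))"
    by (simp add: L.scaleR L.add assms(2))
  also have "\<dots> = wirtinger (h c) i (\<lambda>y. L (f y)) x"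
  proof -
    have "f differentiable (at x)"
      using smooth_on_has_derivative[OF assms(3) x] by (auto simp: differentiable_def)
    then show ?thesis
      by (simp add: wirtinger_def frechet_bounded_linear[OF assms(1)] scaleR_conv_of_real)
  qed
  finally show ?thesis .
qed

lemma wirtinger_cnj: "smooth_on f V \<Longrightarrow> wirtinger c i (\<lambda>y. cnj (f y)) x = cnj (wirtinger (cnj c) i f x)"
  using wirtinger_bounded_linear[OF bounded_linear_cnj complex_cnj_mult, of f "cnj c" i] by simp

lemma wirtinger_cmult: "smooth_on f V \<Longrightarrow> wirtinger c i (\<lambda>y. a * f y) x = a * wirtinger c i f x"
  using wirtinger_bounded_linear[OF bounded_linear_mult_right[of a], of "\<lambda>c. c" f c i] by (simp add: ac_simps)

lemma wirtinger_uminus: "smooth_on f V \<Longrightarrow> wirtinger c i (\<lambda>y. - f y) x = - wirtinger c i f x"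
  using wirtinger_cmult[of f c i "-1"] by simp

lemma wirtinger_const: "wirtinger c i (\<lambda>y. a) x = 0"
  by (simp add: wirtinger_def)

lemma wirtinger_add:
  assumes "smooth_on f V" "smooth_on g V"
  shows "wirtinger c i (\<lambda>y. f y + g y) x = wirtinger c i f x + wirtinger c i g x"
proof -
  have "((\<lambda>y. f y + g y) has_derivative
     (\<lambda>v. frechet_derivative f (at x) v + frechet_derivative g (at x) v)) (at x)"
    by (intro has_derivative_add smooth_on_has_derivative[OF _ x] assms)
  from frechet_derivative_at[OF this, symmetric] show ?thesis
    by (simp add: wirtinger_def field_simps)
qed

lemma wirtinger_diff:
  assumes "smooth_on f V" "smooth_on g V"
  shows "wirtinger c i (\<lambda>y. f y - g y) x = wirtinger c i f x - wirtinger c i g x"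
  using wirtinger_add[OF assms(1) smooth_on_uminus[OF V assms(2)]] wirtinger_uminus[OF assms(2)] by simp

lemma wirtinger_mult:
  assumes "smooth_on f V" "smooth_on g V"
  shows "wirtinger c i (\<lambda>y. f y * g y) x = f x * wirtinger c i g x + wirtinger c i f x * g x"
proof -
  have "((\<lambda>y. f y * g y) has_derivative
     (\<lambda>v. f x * frechet_derivative g (at x) v + frechet_derivative f (at x) v * g x)) (at x)"
    by (intro has_derivative_mult smooth_on_has_derivative[OF _ x] assms)
  from frechet_derivative_at[OF this, symmetric] show ?thesis
    by (simp add: wirtinger_def field_simps)
qed

lemma wirtinger_sum:
  "(\<And>i. i \<in> I \<Longrightarrow> smooth_on (f i) V) \<Longrightarrow> wirtinger c k (\<lambda>y. \<Sum>i\<in>I. f i y) x = (\<Sum>i\<in>I. wirtinger c k (f i) x)"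
  by (induction I rule: infinite_finite_induct) (auto simp: wirtinger_const wirtinger_add V smooth_on_sum)

lemma wirtinger_prod:
  "(\<And>i. i \<in> I \<Longrightarrow> smooth_on (f i) V) \<Longrightarrow> finite I \<Longrightarrow>
    wirtinger c k (\<lambda>y. \<Prod>i\<in>I. f i y) x = (\<Sum>i\<in>I. wirtinger c k (f i) x * (\<Prod>j\<in>I - {i}. f j x))"
proof -
  assume sm: "\<And>i. i \<in> I \<Longrightarrow> smooth_on (f i) V" and "finite I"
  have "((\<lambda>y. \<Prod>i\<in>I. f i y) has_derivative
    (\<lambda>v. \<Sum>i\<in>I. frechet_derivative (f i) (at x) v * (\<Prod>j\<in>I - {i}. f j x))) (at x)"
    by (intro has_derivative_prod smooth_on_has_derivative[OF _ x] sm)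
  from frechet_derivative_at[OF this, symmetric] show ?thesis
    by (simp add: wirtinger_def sum_distrib_left flip: sum.distrib sum_divide_distrib)
      (simp add: algebra_simps)
qed

lemma wirtinger_commute:
  assumes f: "smooth_on f V"
  shows "wirtinger c i (wirtinger d j f) x = wirtinger d j (wirtinger c i f) x"
proof -
  define D where "D v y = frechet_derivative f (at y) v" for v y
  have sD: "smooth_on (D v) V" for v
    unfolding D_def using f by (rule smooth_on_frechet)
  have e: "wirtinger c i f = (\<lambda>y. (1/2) * (D (axis i 1) y + c * D (axis i \<i>) y))" for c i
    by (simp add: fun_eq_iff wirtinger_def D_def)
  have smc: "smooth_on (\<lambda>y. a * D v y) V" for a v
    by (intro smooth_on_mult[OF V] smooth_on_const[OF V] sD)
  have w: "wirtinger c i (wirtinger d j f) x = (1/2) * (wirtinger c i (D (axis j 1)) x + d * wirtinger c i (D (axis j \<i>)) x)" for c d i j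
    unfolding e[of d j]
    by (subst wirtinger_cmult, intro smooth_on_add[OF V] sD smc, subst wirtinger_add[OF sD smc], subst wirtinger_cmult[OF sD]) simp
  have "frechet_derivative (D v) (at x) w = frechet_derivative (D w) (at x) v" for v w
    unfolding D_def[abs_def] by (rule symmetric_second_derivative[OF V f x])
  then show ?thesis
    unfolding w by (simp add: wirtinger_def algebra_simps add_divide_distrib)
qed

end

lemma smooth_on_wirtinger: "open V \<Longrightarrow> smooth_on f V \<Longrightarrow> smooth_on (wirtinger c i f) V"
proof -
  assume V: "open V" and f: "smooth_on f V"
  have "smooth_on (\<lambda>x. (1 / 2) * (frechet_derivative f (at x) (axis i 1)
                + c * frechet_derivative f (at x) (axis i \<i>))) V"
    by (intro smooth_on_mult[OF V] smooth_on_add[OF V] smooth_on_const[OF V] smooth_on_frechet f)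
  then show ?thesis by (simp add: wirtinger_def[abs_def])
qed

lemma integral_by_parts_wirtinger:
  fixes A \<psi> :: "complex^'n::finite \<Rightarrow> complex"
  assumes V: "open V" and A: "smooth_on A V" and \<psi>: "smooth_on \<psi> UNIV"
    and K: "compact K" "K \<subseteq> V" "\<And>x. x \<notin> K \<Longrightarrow> \<psi> x = 0"
  shows "(LINT x:V|lborel. A x * wirtinger c i \<psi> x) = - (LINT x:V|lborel. wirtinger c i A x * \<psi> x)"
proof -
  have \<psi>V: "smooth_on \<psi> V" using \<psi> by (rule smooth_on_subset) simp
  have d\<psi>0: "frechet_derivative \<psi> (at x) v = 0" if "x \<notin> K" for x v
    by (rule frechet_derivative_eq_0_off_compact[OF K(1,3) that])
  note cont = smooth_on_imp_continuous_on
  have i1: "set_integrable lborel V (\<lambda>x. A x * frechet_derivative \<psi> (at x) v)" for v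
    by (rule set_integrable_compact_support[OF cont[OF A] cont[OF smooth_on_frechet[OF \<psi>V]] K(1,2)])
      (rule d\<psi>0)
  have i2: "set_integrable lborel V (\<lambda>x. frechet_derivative A (at x) v * \<psi> x)" for v
    by (rule set_integrable_compact_support[OF cont[OF smooth_on_frechet[OF A]] cont[OF \<psi>V] K])
  have "(LINT x:V|lborel. A x * wirtinger c i \<psi> x)
    = (LINT x:V|lborel. (1/2) * (A x * frechet_derivative \<psi> (at x) (axis i 1))
         + (c/2) * (A x * frechet_derivative \<psi> (at x) (axis i \<i>)))"
    by (simp add: wirtinger_def field_simps)
  also have "\<dots> = (1/2) * (LINT x:V|lborel. A x * frechet_derivative \<psi> (at x) (axis i 1))
      + (c/2) * (LINT x:V|lborel. A x * frechet_derivative \<psi> (at x) (axis i \<i>))"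
    by (simp add: i1 set_integral_add(2) del: divide_divide_eq_left times_divide_eq_left)
  also have "\<dots> = - ((1/2) * (LINT x:V|lborel. frechet_derivative A (at x) (axis i 1) * \<psi> x)
      + (c/2) * (LINT x:V|lborel. frechet_derivative A (at x) (axis i \<i>) * \<psi> x))"
    by (simp add: integral_by_parts_frechet[OF V A \<psi> K])
  also have "(1/2) * (LINT x:V|lborel. frechet_derivative A (at x) (axis i 1) * \<psi> x)
      + (c/2) * (LINT x:V|lborel. frechet_derivative A (at x) (axis i \<i>) * \<psi> x)
    = (LINT x:V|lborel. (1/2) * (frechet_derivative A (at x) (axis i 1) * \<psi> x)
         + (c/2) * (frechet_derivative A (at x) (axis i \<i>) * \<psi> x))"
    by (simp add: i2 set_integral_add(2) del: divide_divide_eq_left times_divide_eq_left)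
  also have "\<dots> = (LINT x:V|lborel. wirtinger c i A x * \<psi> x)"
    by (simp add: wirtinger_def field_simps)
  finally show ?thesis .
qed

section \<open>Derivatives of determinants and inverse matrices\<close>

lemma matrix_inv_mult:
  fixes A :: "'a::field^'n^'n"
  assumes "det A \<noteq> 0"
  shows "A ** matrix_inv A = mat 1" "matrix_inv A ** A = mat 1"
proof -
  have "\<exists>B. A ** B = mat 1 \<and> B ** A = mat 1"
    using assms by (simp add: invertible_det_nz flip: invertible_def)
  from someI_ex[OF this] show "A ** matrix_inv A = mat 1" "matrix_inv A ** A = mat 1"
    unfolding matrix_inv_def by auto
qed

lemma smooth_on_det:
  fixes M :: "'a::real_normed_vector \<Rightarrow> complex^'n^'n"
  assumes "open V" "\<And>i j. smooth_on (\<lambda>y. M y $ i $ j) V"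
  shows "smooth_on (\<lambda>y. det (M y)) V"
  unfolding det_def
  by (intro smooth_on_sum smooth_on_prod smooth_on_mult smooth_on_const assms)

text \<open>
  By Cramer's rule the entries of the inverse are quotients of determinants.
\<close>

lemma smooth_on_matrix_inv:
  fixes M :: "'a::real_normed_vector \<Rightarrow> complex^'n^'n"
  assumes V: "open V" and M: "\<And>i j. smooth_on (\<lambda>y. M y $ i $ j) V"
    and nz: "\<And>y. y \<in> V \<Longrightarrow> det (M y) \<noteq> 0"
  shows "smooth_on (\<lambda>y. matrix_inv (M y) $ k $ l) V"
proof (rule smooth_on_cong)
  let ?N = "\<lambda>y. (\<chi> i j. if j = k then axis l 1 $ i else M y $ i $ j) :: complex^'n^'n"
  have "smooth_on (\<lambda>y. ?N y $ i $ j) V" for i j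
    by (cases "j = k") (simp_all add: smooth_on_const V M)
  then show "smooth_on (\<lambda>y. det (?N y) * inverse (det (M y))) V"
    by (intro smooth_on_mult smooth_on_inverse smooth_on_det V M nz)
  fix y assume y: "y \<in> V"
  have "M y *v (matrix_inv (M y) *v axis l 1) = axis l 1"
    by (simp add: matrix_vector_mul_assoc matrix_inv_mult[OF nz[OF y]])
  then have "matrix_inv (M y) *v axis l 1
     = (\<chi> k. det (\<chi> i j. if j = k then axis l 1 $ i else M y $ i $ j) / det (M y))"
    unfolding cramer[OF nz[OF y]] .
  then have "(matrix_inv (M y) *v axis l 1) $ k = det (?N y) / det (M y)"
    by simp
  then show "det (?N y) * inverse (det (M y)) = matrix_inv (M y) $ k $ l"
    by (simp add: matrix_vector_mult_def axis_def divide_inverse if_distrib cong: if_cong)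
qed (fact V)

text \<open>
  Differentiating the determinant one row at a time gives a sum of determinants in which row \<open>k\<close> is
  replaced by its derivative. That row is a linear combination of the rows of \<open>M x\<close>, with coefficients
  \<open>w k\<close> obtained by multiplying with the inverse, so the \<open>k\<close>-th summand is \<open>w k $ k * det (M x)\<close>.
\<close>

lemma jacobi_formula:
  fixes M :: "complex^'m::finite \<Rightarrow> complex^'n^'n"
  assumes V: "open V" and x: "x \<in> V" and M: "\<And>i j. smooth_on (\<lambda>y. M y $ i $ j) V"
    and nz: "det (M x) \<noteq> 0"
  shows "wirtinger c l (\<lambda>y. det (M y)) x
    = det (M x) * (\<Sum>a\<in>UNIV. \<Sum>b\<in>UNIV. matrix_inv (M x) $ b $ a * wirtinger c l (\<lambda>y. M y $ a $ b) x)"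
proof -
  let ?P = "{p. p permutes (UNIV :: 'n set)}"
  define dM where "dM a b = wirtinger c l (\<lambda>y. M y $ a $ b) x" for a b
  define w where "w k = (\<chi> i. \<Sum>b\<in>UNIV. dM k b * matrix_inv (M x) $ b $ i)" for k
  have inv: "(\<Sum>i\<in>UNIV. matrix_inv (M x) $ b $ i * M x $ i $ j) = (if b = j then 1 else 0)" for b j
    using matrix_inv_mult(2)[OF nz] by (simp add: matrix_matrix_mult_def mat_def vec_eq_iff)
  have row: "(\<Sum>i\<in>UNIV. w k $ i * M x $ i $ j) = dM k j" for k j
  proof -
    have "(\<Sum>i\<in>UNIV. w k $ i * M x $ i $ j)
      = (\<Sum>b\<in>UNIV. dM k b * (\<Sum>i\<in>UNIV. matrix_inv (M x) $ b $ i * M x $ i $ j))"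
      unfolding w_def by (simp add: sum_distrib_right sum_distrib_left mult.assoc) (rule sum.swap)
    then show ?thesis by (simp add: inv if_distrib cong: if_cong)
  qed
  have detk: "det (\<chi> i. if i = k then (\<chi> j. dM k j) else M x $ i) = w k $ k * det (M x)" for k
  proof -
    have r: "Finite_Cartesian_Product.row i (M x) = M x $ i" for i
      by (simp add: row_def vec_eq_iff)
    have "(\<Sum>i\<in>UNIV. w k $ i *s M x $ i) = (\<chi> j. dM k j)"
      by (simp add: vec_eq_iff row)
    then show ?thesis
      using cramer_lemma_transpose[of k "w k" "M x"] unfolding r by metis
  qed
  have "wirtinger c l (\<lambda>y. det (M y)) x
      = (\<Sum>p\<in>?P. of_int (sign p) * (\<Sum>k\<in>UNIV. dM k (p k) * (\<Prod>j\<in>UNIV - {k}. M x $ j $ p j)))"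
    unfolding det_def dM_def
    by (subst wirtinger_sum[OF V x], intro smooth_on_mult smooth_on_const smooth_on_prod V M,
       rule sum.cong[OF refl], subst wirtinger_cmult[OF V x], intro smooth_on_prod V M,
       subst wirtinger_prod[OF V x]) (auto intro: M)
  also have "\<dots> = (\<Sum>k\<in>UNIV. \<Sum>p\<in>?P. of_int (sign p) * (dM k (p k) * (\<Prod>j\<in>UNIV - {k}. M x $ j $ p j)))"
    by (simp add: sum_distrib_left) (rule sum.swap)
  also have "\<dots> = (\<Sum>k\<in>UNIV. det (\<chi> i. if i = k then (\<chi> j. dM k j) else M x $ i))"
  proof (intro sum.cong refl)
    fix k
    show "(\<Sum>p\<in>?P. of_int (sign p) * (dM k (p k) * (\<Prod>j\<in>UNIV - {k}. M x $ j $ p j)))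
        = det (\<chi> i. if i = k then (\<chi> j. dM k j) else M x $ i)"
      unfolding det_def
    proof (intro sum.cong refl arg_cong2[where f = "(*)"])
      fix p :: "'n \<Rightarrow> 'n"
      have "(\<Prod>i\<in>UNIV. (\<chi> i. if i = k then (\<chi> j. dM k j) else M x $ i) $ i $ p i)
        = dM k (p k) * (\<Prod>i\<in>UNIV - {k}. (\<chi> i. if i = k then (\<chi> j. dM k j) else M x $ i) $ i $ p i)"
        by (subst prod.remove[of _ k]) auto
      also have "(\<Prod>i\<in>UNIV - {k}. (\<chi> i. if i = k then (\<chi> j. dM k j) else M x $ i) $ i $ p i)
        = (\<Prod>j\<in>UNIV - {k}. M x $ j $ p j)"
        by (rule prod.cong) auto
      finally show "dM k (p k) * (\<Prod>j\<in>UNIV - {k}. M x $ j $ p j)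
         = (\<Prod>i\<in>UNIV. (\<chi> i. if i = k then (\<chi> j. dM k j) else M x $ i) $ i $ p i)" ..
    qed
  qed
  also have "\<dots> = (\<Sum>k\<in>UNIV. w k $ k * det (M x))" by (simp only: detk)
  finally show ?thesis
    by (simp add: w_def dM_def sum_distrib_left sum_distrib_right ac_simps)
qed

lemma wirtinger_matrix_inv:
  fixes M :: "complex^'m::finite \<Rightarrow> complex^'n^'n"
  assumes V: "open V" and x: "x \<in> V" and M: "\<And>i j. smooth_on (\<lambda>y. M y $ i $ j) V"
    and nz: "\<And>y. y \<in> V \<Longrightarrow> det (M y) \<noteq> 0"
  shows "wirtinger c l (\<lambda>y. matrix_inv (M y) $ j $ i) x
    = - (\<Sum>a\<in>UNIV. \<Sum>b\<in>UNIV. matrix_inv (M x) $ j $ a * wirtinger c l (\<lambda>y. M y $ a $ b) x * matrix_inv (M x) $ b $ i)"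
proof -
  define N where "N y = matrix_inv (M y)" for y
  have N: "smooth_on (\<lambda>y. N y $ a $ b) V" for a b
    unfolding N_def by (rule smooth_on_matrix_inv[OF V M nz])
  have NM: "(\<Sum>a\<in>UNIV. N y $ j $ a * M y $ a $ b) = (if j = b then 1 else 0)" if "y \<in> V" for y j b
    using matrix_inv_mult(2)[OF nz[OF that]] by (simp add: N_def matrix_matrix_mult_def mat_def vec_eq_iff)
  have MN: "(\<Sum>b\<in>UNIV. M x $ a $ b * N x $ b $ i) = (if a = i then 1 else 0)" for a i
    using matrix_inv_mult(1)[OF nz[OF x]] by (simp add: N_def matrix_matrix_mult_def mat_def vec_eq_iff)
  define dN where "dN a = wirtinger c l (\<lambda>y. N y $ j $ a) x" for a
  define dM where "dM a b = wirtinger c l (\<lambda>y. M y $ a $ b) x" for a b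
  have d0: "(\<Sum>a\<in>UNIV. dN a * M x $ a $ b) = - (\<Sum>a\<in>UNIV. N x $ j $ a * dM a b)" for b
  proof -
    have "0 = wirtinger c l (\<lambda>y. \<Sum>a\<in>UNIV. N y $ j $ a * M y $ a $ b) x"
      by (subst wirtinger_cong[OF V x NM]) (auto simp: wirtinger_const[OF V x])
    also have "\<dots> = (\<Sum>a\<in>UNIV. N x $ j $ a * dM a b + dN a * M x $ a $ b)"
      unfolding dN_def dM_def
      by (subst wirtinger_sum[OF V x], intro smooth_on_mult V N M) (simp add: wirtinger_mult[OF V x N M])
    finally show ?thesis by (simp add: sum.distrib eq_neg_iff_add_eq_0 add.commute)
  qed
  have "dN i = (\<Sum>a\<in>UNIV. dN a * (\<Sum>b\<in>UNIV. M x $ a $ b * N x $ b $ i))"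
    by (simp add: MN if_distrib cong: if_cong)
  also have "\<dots> = (\<Sum>b\<in>UNIV. (\<Sum>a\<in>UNIV. dN a * M x $ a $ b) * N x $ b $ i)"
    by (simp add: sum_distrib_left sum_distrib_right mult.assoc) (rule sum.swap)
  also have "\<dots> = - (\<Sum>b\<in>UNIV. (\<Sum>a\<in>UNIV. N x $ j $ a * dM a b) * N x $ b $ i)"
    by (simp add: d0 sum_negf)
  also have "(\<Sum>b\<in>UNIV. (\<Sum>a\<in>UNIV. N x $ j $ a * dM a b) * N x $ b $ i)
     = (\<Sum>a\<in>UNIV. \<Sum>b\<in>UNIV. N x $ j $ a * dM a b * N x $ b $ i)"
    by (simp add: sum_distrib_right) (rule sum.swap)
  finally show ?thesis by (simp add: dN_def dM_def N_def)
qed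

section \<open>Positive Hermitian matrices\<close>

definition positive_hermitian :: "complex^'n^'n \<Rightarrow> bool" where
  "positive_hermitian A \<longleftrightarrow> (\<forall>i j. cnj (A $ i $ j) = A $ j $ i) \<and>
     (\<forall>v. v \<noteq> 0 \<longrightarrow> Re (\<Sum>i\<in>UNIV. \<Sum>j\<in>UNIV. v $ i * A $ i $ j * cnj (v $ j)) > 0)"

lemma positive_hermitian_det_nz:
  fixes A :: "complex^'n^'n"
  assumes "positive_hermitian A" shows "det A \<noteq> 0"
proof
  assume "det A = 0"
  then obtain w where w: "w \<noteq> 0" "A *v w = 0"
    using invertible_det_nz[of A] invertible_left_inverse[of A] matrix_left_invertible_ker[of A] by auto
  define v where "v = (\<chi> i. cnj (w $ i))"
  have "v \<noteq> 0" using w(1) by (auto simp: v_def vec_eq_iff)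
  moreover have "(\<Sum>i\<in>UNIV. \<Sum>j\<in>UNIV. v $ i * A $ i $ j * cnj (v $ j)) = (\<Sum>i\<in>UNIV. v $ i * (A *v w) $ i)"
    by (simp add: v_def matrix_vector_mult_def sum_distrib_left mult.assoc)
  ultimately show False
    using assms w(2) unfolding positive_hermitian_def by (metis (no_types, lifting) less_irrefl mult_zero_right sum.neutral zero_complex.sel(1) zero_index)
qed

lemma hermitian_det_real:
  fixes A :: "complex^'n^'n"
  assumes "\<And>i j. cnj (A $ i $ j) = A $ j $ i" shows "det A = of_real (Re (det A))"
proof -
  have "cnj (det A) = det (transpose A)"
    by (simp add: det_def assms transpose_def)
  then show ?thesis by (simp add: det_transpose complex_eq_iff)
qed

text \<open>
  The segment from the identity to \<open>A\<close> consists of positive Hermitian matrices, whose determinants are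
  real and nonzero; the sign is thus the same at both ends.
\<close>

lemma positive_hermitian_det_pos:
  fixes A :: "complex^'n^'n"
  assumes A: "positive_hermitian A" shows "Re (det A) > 0"
proof (rule ccontr)
  assume neg: "\<not> Re (det A) > 0"
  define B :: "real \<Rightarrow> complex^'n^'n" where
    "B t = (\<chi> i j. of_real (1 - t) * (if i = j then 1 else 0) + of_real t * A $ i $ j)" for t
  have pos: "positive_hermitian (B t)" if t: "0 \<le> t" "t \<le> 1" for t
    unfolding positive_hermitian_def
  proof (intro conjI allI impI)
    show "cnj (B t $ i $ j) = B t $ j $ i" for i j
      using A by (simp add: B_def positive_hermitian_def)
    fix v :: "complex^'n" assume v: "v \<noteq> 0"
    define q where "q = Re (\<Sum>i\<in>UNIV. \<Sum>j\<in>UNIV. v $ i * A $ i $ j * cnj (v $ j))"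
    define s where "s = (\<Sum>i\<in>UNIV. (cmod (v $ i))\<^sup>2)"
    have q: "q > 0" using A v by (simp add: positive_hermitian_def q_def)
    obtain k where "v $ k \<noteq> 0" using v by (auto simp: vec_eq_iff)
    then have s: "s > 0" unfolding s_def by (intro sum_pos2[of _ k]) auto
    have "(\<Sum>i\<in>UNIV. \<Sum>j\<in>UNIV. v $ i * B t $ i $ j * cnj (v $ j))
      = (\<Sum>i\<in>UNIV. \<Sum>j\<in>UNIV. of_real (1 - t) * (if i = j then v $ i * cnj (v $ j) else 0)
           + of_real t * (v $ i * A $ i $ j * cnj (v $ j)))"
      by (intro sum.cong refl) (simp add: B_def algebra_simps)
    also have "\<dots> = of_real (1 - t) * of_real s
        + of_real t * (\<Sum>i\<in>UNIV. \<Sum>j\<in>UNIV. v $ i * A $ i $ j * cnj (v $ j))"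
    proof -
      have "(\<Sum>j\<in>UNIV. of_real (1 - t) * (if i = j then v $ i * cnj (v $ j) else 0))
          = of_real (1 - t) * (v $ i * cnj (v $ i))" for i
        by (simp del: of_real_diff flip: sum_distrib_left)
      moreover have "of_real s = (\<Sum>i\<in>UNIV. v $ i * cnj (v $ i))"
        by (simp add: s_def complex_norm_square del: of_real_power)
      ultimately show ?thesis
        by (simp add: sum.distrib del: of_real_diff flip: sum_distrib_left)
    qed
    finally have "Re (\<Sum>i\<in>UNIV. \<Sum>j\<in>UNIV. v $ i * B t $ i $ j * cnj (v $ j)) = (1 - t) * s + t * q"
      by (simp add: q_def)
    also have "\<dots> > 0"
      using t q s by (cases "t = 0") (auto intro: add_nonneg_pos)
    finally show "Re (\<Sum>i\<in>UNIV. \<Sum>j\<in>UNIV. v $ i * B t $ i $ j * cnj (v $ j)) > 0" .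
  qed
  have "continuous_on {0..1} (\<lambda>t. Re (det (B t)))"
    unfolding det_def B_def by (auto intro!: continuous_intros)
  moreover have "B 0 = mat 1" "B 1 = A"
    by (auto simp: B_def mat_def vec_eq_iff)
  ultimately obtain t where t: "0 \<le> t" "t \<le> 1" "Re (det (B t)) = 0"
    using IVT2'[of "\<lambda>t. Re (det (B t))" 1 0 0] neg by auto
  have "det (B t) = of_real (Re (det (B t)))"
    by (rule hermitian_det_real) (use pos[OF t(1,2)] in \<open>simp add: positive_hermitian_def\<close>)
  with t positive_hermitian_det_nz[OF pos[OF t(1,2)]] show False by simp
qed

section \<open>A Hermitian metric in a chart\<close>

locale hermitian_chart =
  fixes V :: "(complex^'n::finite) set" and b :: "'n local_metric"
  assumes V: "open V"
    and smooth_b: "\<And>u v. smooth_on (\<lambda>x. b x u v) V"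
    and bilinear_b: "\<And>x. x \<in> V \<Longrightarrow> bilinear (b x)"
    and sym_b: "\<And>x u v. x \<in> V \<Longrightarrow> b x u v = b x v u"
    and pos_b: "\<And>x u. x \<in> V \<Longrightarrow> u \<noteq> 0 \<Longrightarrow> b x u u > 0"
    and J_b: "\<And>x u v. x \<in> V \<Longrightarrow> b x (\<i> *s u) (\<i> *s v) = b x u v"
begin

definition G :: "'n \<Rightarrow> 'n \<Rightarrow> complex^'n \<Rightarrow> complex" where
  "G i j y = metric_matrix b y $ i $ j"

definition H :: "'n \<Rightarrow> 'n \<Rightarrow> complex^'n \<Rightarrow> complex" where
  "H j i y = metric_inv b y $ j $ i"

definition D :: "complex^'n \<Rightarrow> complex" where
  "D y = det (metric_matrix b y)"

lemma axis_ii: "axis i \<i> = (\<i> *s axis i 1 :: complex^'n)"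
  by (simp add: vec_eq_iff axis_def)

lemma J_J: "\<i> *s (\<i> *s u) = - (u :: complex^'n)"
  by (simp add: vec_eq_iff mult.assoc[symmetric])

context
  fixes x assumes x: "x \<in> V"
begin

lemma b_minus: "b x (- u) v = - b x u v" "b x u (- v) = - b x u v"
  using bilinear_lneg[OF bilinear_b[OF x]] bilinear_rneg[OF bilinear_b[OF x]] by auto

lemma b_J_left: "b x (\<i> *s u) v = - b x u (\<i> *s v)"
  using J_b[OF x, of "\<i> *s u" v] by (simp add: J_J b_minus)

text \<open>
  The sesquilinear form with \<open>hform u u = b x u u / 2\<close>. Its values on the standard complex basis are the
  entries of the metric matrix, so positivity of that matrix is positivity of \<open>b\<close>.
\<close>

definition hform where
  "hform u v = (of_real (b x u v) + \<i> * of_real (b x u (\<i> *s v))) / 2"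

lemma G_eq_hform: "G i j x = hform (axis i 1) (axis j 1)"
  using b_J_left[of "axis i 1" "axis j 1"]
  by (simp add: G_def metric_matrix_def mixed_component_def hform_def axis_ii J_b[OF x] field_simps)

lemma fundamental_form_eq: "fundamental_form b [i] [j] x = \<i> * G i j x"
  using b_J_left[of "axis i 1" "axis j 1"]
  by (simp add: G_eq_hform fundamental_form_def mixed_component_def hform_def axis_ii J_J J_b[OF x]
      b_minus field_simps)

lemma complex_scale: "c *s u = Re c *\<^sub>R u + Im c *\<^sub>R (\<i> *s (u :: complex^'n))"
proof -
  have "c * z = of_real (Re c) * z + of_real (Im c) * (\<i> * z)" for z
    by (subst (1) complex_eq[of c]) (simp add: algebra_simps)
  then show ?thesis by (simp add: vec_eq_iff scaleR_conv_of_real[where 'a = complex])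
qed

lemma hform_scale: "hform (c *s u) v = c * hform u v" "hform u (c *s v) = cnj c * hform u v"
proof -
  have c: "c = of_real (Re c) + \<i> * of_real (Im c)" by (rule complex_eq)
  note bl = bilinear_ladd[OF bilinear_b[OF x]] bilinear_radd[OF bilinear_b[OF x]]
    bilinear_lmul[OF bilinear_b[OF x]] bilinear_rmul[OF bilinear_b[OF x]]
  show "hform (c *s u) v = c * hform u v"
    unfolding complex_scale[of c u]
    by (simp add: hform_def bl b_J_left J_J b_minus complex_eq_iff algebra_simps)
  have "\<i> *s (c *s v) = Re c *\<^sub>R (\<i> *s v) + Im c *\<^sub>R (- v)"
    unfolding complex_scale[of c v]
    by (simp add: vec_eq_iff scaleR_conv_of_real[where 'a = complex] algebra_simps)
  then show "hform u (c *s v) = cnj c * hform u v"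
    unfolding hform_def by (simp only: complex_scale[of c v] bl b_minus)
      (simp add: complex_eq_iff bl b_minus algebra_simps)
qed

lemma hform_sum: "hform (sum f I) v = (\<Sum>i\<in>I. hform (f i) v)" "hform u (sum f I) = (\<Sum>i\<in>I. hform u (f i))"
proof -
  note bl = bilinear_ladd[OF bilinear_b[OF x]] bilinear_radd[OF bilinear_b[OF x]]
    bilinear_lzero[OF bilinear_b[OF x]] bilinear_rzero[OF bilinear_b[OF x]]
  have add: "hform (u + u') v = hform u v + hform u' v" "hform u (v + v') = hform u v + hform u v'" for u u' v v'
    by (simp_all add: hform_def bl vector_add_ldistrib field_simps)
  have zero: "hform 0 v = 0" "hform u 0 = 0" for u v
    by (simp_all add: hform_def bl)
  show "hform (sum f I) v = (\<Sum>i\<in>I. hform (f i) v)" "hform u (sum f I) = (\<Sum>i\<in>I. hform u (f i))"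
    by (induction I rule: infinite_finite_induct) (simp_all add: add zero)
qed

lemma hform_expand: "hform u v = (\<Sum>i\<in>UNIV. \<Sum>j\<in>UNIV. u $ i * G i j x * cnj (v $ j))"
proof -
  have "hform u v = hform (\<Sum>i\<in>UNIV. u $ i *s axis i 1) (\<Sum>j\<in>UNIV. v $ j *s axis j 1)"
    by (simp add: basis_expansion)
  then show ?thesis
    by (simp add: hform_sum hform_scale G_eq_hform sum_distrib_left ac_simps) (rule sum.swap)
qed

lemma hform_self: "hform u u = of_real (b x u u) / 2"
proof -
  have "b x u (\<i> *s u) = - b x u (\<i> *s u)"
    using b_J_left[of u u] sym_b[OF x, of "\<i> *s u" u] by simp
  then show ?thesis by (simp add: hform_def)
qed

lemma cnj_hform: "cnj (hform u v) = hform v u"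
  using b_J_left[of v u] by (simp add: hform_def sym_b[OF x, of u])

lemma positive_hermitian_metric: "positive_hermitian (metric_matrix b x)"
  unfolding positive_hermitian_def
proof (intro conjI allI impI)
  show "cnj (metric_matrix b x $ i $ j) = metric_matrix b x $ j $ i" for i j
    using cnj_hform by (simp add: G_eq_hform flip: G_def)
  show "Re (\<Sum>i\<in>UNIV. \<Sum>j\<in>UNIV. v $ i * metric_matrix b x $ i $ j * cnj (v $ j)) > 0"
    if "v \<noteq> 0" for v
    using pos_b[OF x that] by (simp only: G_def[symmetric] hform_expand[symmetric]) (simp add: hform_self)
qed

lemma D_real: "D x = of_real (Re (D x))"
  unfolding D_def using positive_hermitian_metric
  by (intro hermitian_det_real) (simp add: positive_hermitian_def)

lemma D_pos: "Re (D x) > 0"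
  unfolding D_def by (rule positive_hermitian_det_pos[OF positive_hermitian_metric])

lemma D_nz: "D x \<noteq> 0"
  using D_pos by auto

lemma G_hermitian: "cnj (G i j x) = G j i x"
  by (simp add: G_eq_hform cnj_hform)

lemma GH: "(\<Sum>k\<in>UNIV. G i k x * H k j x) = (if i = j then 1 else 0)"
  using matrix_inv_mult(1)[OF D_nz[unfolded D_def]]
  by (simp add: G_def H_def metric_inv_def matrix_matrix_mult_def mat_def vec_eq_iff)

lemma HG: "(\<Sum>k\<in>UNIV. H i k x * G k j x) = (if i = j then 1 else 0)"
  using matrix_inv_mult(2)[OF D_nz[unfolded D_def]]
  by (simp add: G_def H_def metric_inv_def matrix_matrix_mult_def mat_def vec_eq_iff)

text \<open>
  The conjugate transpose of \<open>H\<close> is a left inverse of \<open>G\<close> as well, and inverses are unique.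
\<close>

lemma H_hermitian: "cnj (H i j x) = H j i x"
proof -
  have G_cnjH: "(\<Sum>k\<in>UNIV. cnj (H k i x) * G k j x) = (if i = j then 1 else 0)" for i j
  proof -
    have "(\<Sum>k\<in>UNIV. cnj (H k i x) * G k j x) = cnj (\<Sum>k\<in>UNIV. G j k x * H k i x)"
      by (simp add: G_hermitian mult.commute)
    then show ?thesis by (simp add: GH)
  qed
  have "cnj (H i j x) = (\<Sum>k\<in>UNIV. cnj (H k j x) * (\<Sum>l\<in>UNIV. G k l x * H l i x))"
    by (simp add: GH if_distrib cong: if_cong)
  also have "\<dots> = (\<Sum>l\<in>UNIV. (\<Sum>k\<in>UNIV. cnj (H k j x) * G k l x) * H l i x)"
    by (simp add: sum_distrib_left sum_distrib_right mult.assoc) (rule sum.swap)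
  also have "\<dots> = H j i x"
    by (simp add: G_cnjH if_distrib if_distribR cong: if_cong)
  finally show ?thesis .
qed

end

lemma smooth_metric_matrix: "smooth_on (\<lambda>y. metric_matrix b y $ i $ j) V"
proof -
  have "smooth_on (\<lambda>y. (of_real (b y (axis i 1) (axis j 1)) + of_real (b y (axis i \<i>) (axis j \<i>))
      + \<i> * of_real (b y (axis i 1) (axis j \<i>)) - \<i> * of_real (b y (axis i \<i>) (axis j 1))) * (1 / 4 :: complex)) V"
    by (intro smooth_on_mult smooth_on_add smooth_on_diff smooth_on_const smooth_on_of_real smooth_b V)
  then show ?thesis by (simp add: metric_matrix_def mixed_component_def)
qed

lemma smooth_G: "smooth_on (G i j) V"
  using smooth_metric_matrix by (simp add: G_def[abs_def])

lemma smooth_D: "smooth_on D V"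
  unfolding D_def[abs_def] by (intro smooth_on_det V smooth_metric_matrix)

lemma smooth_H: "smooth_on (H i j) V"
  unfolding H_def[abs_def] metric_inv_def
  by (intro smooth_on_matrix_inv V smooth_metric_matrix) (use D_nz D_def in metis)

definition T :: "'n \<Rightarrow> 'n \<Rightarrow> 'n \<Rightarrow> complex^'n \<Rightarrow> complex" where
  "T i j k y = wirtinger (- \<i>) i (G j k) y - wirtinger (- \<i>) j (G i k) y"

definition tau :: "'n \<Rightarrow> complex^'n \<Rightarrow> complex" where
  "tau i y = (\<Sum>l\<in>UNIV. \<Sum>q\<in>UNIV. H q l y * T i l q y)"

lemma torsion_eq: "torsion b i j k y = T i j k y"
  by (simp add: torsion_def T_def dz_eq_wirtinger G_def[abs_def])

lemma smooth_T: "smooth_on (T i j k) V"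
  unfolding T_def[abs_def] by (intro smooth_on_diff smooth_on_wirtinger V smooth_G)

lemma smooth_tau: "smooth_on (tau i) V"
  unfolding tau_def[abs_def] by (intro smooth_on_sum smooth_on_mult V smooth_H smooth_T)

lemma wirtinger_D:
  assumes "x \<in> V"
  shows "wirtinger c l D x = D x * (\<Sum>i\<in>UNIV. \<Sum>q\<in>UNIV. H q i x * wirtinger c l (G i q) x)"
  using jacobi_formula[OF V assms smooth_metric_matrix, of c l] D_nz[OF assms]
  by (simp add: G_def[abs_def] H_def D_def[abs_def] metric_inv_def)

lemma wirtinger_H:
  assumes "x \<in> V"
  shows "wirtinger c l (H k p) x = - (\<Sum>i\<in>UNIV. \<Sum>q\<in>UNIV. H k i x * wirtinger c l (G i q) x * H q p x)"
  using wirtinger_matrix_inv[OF V assms smooth_metric_matrix, of c l] D_nz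
  by (simp add: G_def[abs_def] H_def[abs_def] D_def metric_inv_def)

text \<open>
  The derivative of \<open>D\<close> contributes \<open>D H\<^sub>k\<^sub>i H\<^sub>q\<^sub>l \<partial>\<^sub>i G\<^sub>l\<^sub>q\<close> by Jacobi's formula, and the derivative of \<open>H\<close>
  contributes the negative of this expression with \<open>\<partial>\<^sub>l G\<^sub>i\<^sub>q\<close> in place of \<open>\<partial>\<^sub>i G\<^sub>l\<^sub>q\<close>. Together they give the torsion.
\<close>

lemma divergence_H:
  assumes x: "x \<in> V"
  shows "(\<Sum>l\<in>UNIV. wirtinger (- \<i>) l (\<lambda>y. H k l y * D y) x) = D x * (\<Sum>i\<in>UNIV. H k i x * tau i x)"
proof -
  define d where "d l i q = wirtinger (- \<i>) l (G i q) x" for l i q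
  have "(\<Sum>l\<in>UNIV. wirtinger (- \<i>) l (\<lambda>y. H k l y * D y) x)
    = (\<Sum>l\<in>UNIV. D x * (\<Sum>i\<in>UNIV. \<Sum>q\<in>UNIV. H k l x * H q i x * d l i q)
        - D x * (\<Sum>i\<in>UNIV. \<Sum>q\<in>UNIV. H k i x * H q l x * d l i q))"
  proof (rule sum.cong[OF refl])
    fix l
    have "wirtinger (- \<i>) l (\<lambda>y. H k l y * D y) x = H k l x * wirtinger (- \<i>) l D x + wirtinger (- \<i>) l (H k l) x * D x"
      by (rule wirtinger_mult[OF V x smooth_H smooth_D])
    then show "wirtinger (- \<i>) l (\<lambda>y. H k l y * D y) x
      = D x * (\<Sum>i\<in>UNIV. \<Sum>q\<in>UNIV. H k l x * H q i x * d l i q)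
        - D x * (\<Sum>i\<in>UNIV. \<Sum>q\<in>UNIV. H k i x * H q l x * d l i q)"
      by (simp add: wirtinger_D[OF x] wirtinger_H[OF x] d_def sum_distrib_left sum_distrib_right ac_simps)
  qed
  also have "\<dots> = D x * (\<Sum>l\<in>UNIV. \<Sum>i\<in>UNIV. \<Sum>q\<in>UNIV. H k l x * H q i x * d l i q)
        - D x * (\<Sum>l\<in>UNIV. \<Sum>i\<in>UNIV. \<Sum>q\<in>UNIV. H k i x * H q l x * d l i q)"
    by (simp add: sum_subtractf sum_distrib_left)
  also have "(\<Sum>l\<in>UNIV. \<Sum>i\<in>UNIV. \<Sum>q\<in>UNIV. H k i x * H q l x * d l i q)
     = (\<Sum>i\<in>UNIV. \<Sum>l\<in>UNIV. \<Sum>q\<in>UNIV. H k i x * H q l x * d l i q)"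
    by (rule sum.swap)
  finally show ?thesis
    by (simp add: tau_def T_def d_def sum_subtractf sum_distrib_left algebra_simps)
qed

lemma divergence_H_cnj:
  assumes x: "x \<in> V"
  shows "(\<Sum>l\<in>UNIV. wirtinger \<i> l (\<lambda>y. H l k y * D y) x) = D x * (\<Sum>i\<in>UNIV. H i k x * cnj (tau i x))"
proof -
  have D_cnj: "cnj (D y) = D y" if "y \<in> V" for y
    by (subst (1 2) D_real[OF that]) simp
  have "wirtinger \<i> l (\<lambda>y. H l k y * D y) x = cnj (wirtinger (- \<i>) l (\<lambda>y. H k l y * D y) x)" for l
  proof -
    have "wirtinger \<i> l (\<lambda>y. H l k y * D y) x = wirtinger \<i> l (\<lambda>y. cnj (H k l y * D y)) x"
      by (rule wirtinger_cong[OF V x]) (simp add: H_hermitian D_cnj)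
    also have "\<dots> = cnj (wirtinger (cnj \<i>) l (\<lambda>y. H k l y * D y) x)"
      by (rule wirtinger_cnj[OF V x smooth_on_mult[OF V smooth_H smooth_D]])
    finally show ?thesis by simp
  qed
  then have "(\<Sum>l\<in>UNIV. wirtinger \<i> l (\<lambda>y. H l k y * D y) x) = cnj (D x * (\<Sum>i\<in>UNIV. H k i x * tau i x))"
    by (simp flip: divergence_H[OF x])
  then show ?thesis by (simp add: D_cnj[OF x] H_hermitian[OF x])
qed

end

section \<open>Formal adjoints of the fundamental form\<close>

lemma sum_length_1: "(\<Sum>is | length is = Suc 0. f is) = (\<Sum>i\<in>UNIV. f [i :: 'n::finite])"
proof -
  have "{is :: 'n list. length is = Suc 0} = range (\<lambda>i. [i])"
    by (auto simp: length_Suc_conv)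
  then show ?thesis by (simp add: sum.reindex inj_on_def)
qed

lemma set_integral_sum:
  fixes f :: "'i \<Rightarrow> 'a \<Rightarrow> complex"
  assumes "finite I" "\<And>i. i \<in> I \<Longrightarrow> set_integrable M V (f i)"
  shows "(LINT x:V|M. (\<Sum>i\<in>I. f i x)) = (\<Sum>i\<in>I. (LINT x:V|M. f i x))"
  using assms unfolding set_lebesgue_integral_def set_integrable_def scaleR_sum_right
  by (intro Bochner_Integration.integral_sum)

text \<open>
  The conjugated components of a test form of degree \<open>(1,0)\<close> or \<open>(0,1)\<close>. Both degrees are treated through
  such families, which makes the two adjoints instances of the same argument.
\<close>

definition test_family :: "(complex^'n::finite) set \<Rightarrow> ('n \<Rightarrow> complex^'n \<Rightarrow> complex) \<Rightarrow> bool" where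
  "test_family V \<psi> \<longleftrightarrow> (\<forall>k. smooth_on (\<psi> k) UNIV) \<and>
     (\<exists>K. compact K \<and> K \<subseteq> V \<and> (\<forall>k x. x \<notin> K \<longrightarrow> \<psi> k x = 0))"

lemma test_family_integrable:
  assumes "test_family V \<psi>" "continuous_on V A"
  shows "set_integrable lborel V (\<lambda>x. A x * \<psi> k x)"
proof -
  obtain K where K: "compact K" "K \<subseteq> V" "\<And>x. x \<notin> K \<Longrightarrow> \<psi> k x = 0"
    using assms(1) by (auto simp: test_family_def)
  have "continuous_on V (\<psi> k)"
    using assms(1) smooth_on_imp_continuous_on[OF smooth_on_subset[OF _ subset_UNIV]]
    by (auto simp: test_family_def)
  from set_integrable_compact_support[OF assms(2) this K] show ?thesis .
qed

lemma integral_by_parts_family: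
  assumes V: "open V" and \<psi>: "test_family V \<psi>" and A: "\<And>k l. smooth_on (A k l) V"
  shows "(LINT x:V|lborel. (\<Sum>k\<in>UNIV. \<Sum>l\<in>UNIV. A k l x * wirtinger c l (\<psi> k) x))
    = - (LINT x:V|lborel. (\<Sum>k\<in>UNIV. (\<Sum>l\<in>UNIV. wirtinger c l (A k l) x) * \<psi> k x))"
proof -
  obtain K where K: "compact K" "K \<subseteq> V" "\<And>k x. x \<notin> K \<Longrightarrow> \<psi> k x = 0"
    using \<psi> by (auto simp: test_family_def)
  have sm: "smooth_on (\<psi> k) UNIV" for k using \<psi> by (auto simp: test_family_def)
  have w0: "wirtinger c l (\<psi> k) x = 0" if "x \<notin> K" for k l x
    by (simp add: wirtinger_def frechet_derivative_eq_0_off_compact[OF K(1) K(3) that])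
  note cont = smooth_on_imp_continuous_on
  have i1: "set_integrable lborel V (\<lambda>x. A k l x * wirtinger c l (\<psi> k) x)" for k l
    by (rule set_integrable_compact_support[OF cont[OF A] _ K(1,2) w0])
      (rule cont[OF smooth_on_wirtinger[OF V smooth_on_subset[OF sm subset_UNIV]]])
  have i2: "set_integrable lborel V (\<lambda>x. wirtinger c l (A k l) x * \<psi> k x)" for k l
    by (rule test_family_integrable[OF \<psi>]) (rule cont[OF smooth_on_wirtinger[OF V A]])
  have i3: "set_integrable lborel V (\<lambda>x. \<Sum>l\<in>UNIV. A k l x * wirtinger c l (\<psi> k) x)" for k
    using i1 unfolding set_integrable_def scaleR_sum_right by (intro Bochner_Integration.integrable_sum)
  have i4: "set_integrable lborel V (\<lambda>x. \<Sum>l\<in>UNIV. wirtinger c l (A k l) x * \<psi> k x)" for k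
    using i2 unfolding set_integrable_def scaleR_sum_right by (intro Bochner_Integration.integrable_sum)
  show ?thesis
    using integral_by_parts_wirtinger[OF V A sm K]
    by (simp add: set_integral_sum i1 i2 i3 i4 sum_distrib_right sum_negf)
qed

lemma eq_if_weakly_eq:
  assumes V: "open V" and B: "\<And>k. continuous_on V (B k)" "\<And>k. continuous_on V (C k)"
    and eq: "\<And>\<psi>. test_family V \<psi> \<Longrightarrow>
      (LINT x:V|lborel. (\<Sum>k\<in>UNIV. B k x * \<psi> k x)) = (LINT x:V|lborel. (\<Sum>k\<in>UNIV. C k x * \<psi> k x))"
    and x: "x \<in> V"
  shows "B k x = C k x"
proof -
  have "B k x - C k x = 0"
  proof (rule eq_0_if_weakly_0[OF V _ _ x])
    show "continuous_on V (\<lambda>x. B k x - C k x)" by (intro continuous_intros B)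
    fix \<psi> :: "complex^'a \<Rightarrow> complex" and K
    assume \<psi>: "smooth_on \<psi> UNIV" "compact K" "K \<subseteq> V" "\<And>x. x \<notin> K \<Longrightarrow> \<psi> x = 0"
    define \<Psi> where "\<Psi> j x = (if j = k then \<psi> x else 0)" for j x
    have "smooth_on (\<Psi> j) UNIV" for j
      by (cases "j = k") (simp_all add: \<Psi>_def[abs_def] \<psi>(1) smooth_on_const)
    then have \<Psi>: "test_family V \<Psi>"
      using \<psi> by (auto simp: test_family_def \<Psi>_def)
    have "(\<Sum>j\<in>UNIV. F j x * \<Psi> j x) = F k x * \<psi> x" for F x
      by (simp add: \<Psi>_def if_distrib cong: if_cong)
    with eq[OF \<Psi>] have "(LINT x:V|lborel. B k x * \<psi> x) = (LINT x:V|lborel. C k x * \<psi> x)" by simp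
    moreover have "set_integrable lborel V (\<lambda>x. F x * \<psi> x)" if "continuous_on V F" for F
      using test_family_integrable[OF \<Psi> that, of k] by (simp add: \<Psi>_def)
    ultimately show "(LINT x:V|lborel. (B k x - C k x) * \<psi> x) = 0"
      using B by (simp add: left_diff_distrib set_integral_diff(2))
  qed
  then show ?thesis by simp
qed

lemma form_on_vector:
  assumes "p + q = 1"
  shows "form_on p q V \<alpha> \<longleftrightarrow> (\<forall>is js. length is = p \<and> length js = q \<longrightarrow> smooth_on (\<alpha> is js) V)"
proof -
  have "p = 1 \<and> q = 0 \<or> p = 0 \<and> q = 1" using assms by arith
  then show ?thesis unfolding form_on_def by auto
qed

lemma test_form_of_family:
  assumes "p + q = 1" "test_family V \<psi>"
  shows "test_form p q V (\<lambda>is js x. cnj (\<psi> (hd (is @ js)) x))"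
  using assms unfolding test_form_def form_on_vector[OF assms(1)] test_family_def
  by (auto intro: smooth_on_cnj)

lemma test_family_of_form:
  assumes "p + q = 1" "test_form p q V \<eta>" and "\<And>k. length (a k) = p \<and> length (c k) = q"
  shows "test_family V (\<lambda>k x. cnj (\<eta> (a k) (c k) x))"
  using assms(2,3) unfolding test_form_def form_on_vector[OF assms(1)] test_family_def
  by (metis complex_cnj_zero_iff open_UNIV smooth_on_cnj)

context hermitian_chart
begin

lemma form_inner_1_0: "form_inner 1 0 b \<alpha> \<beta> x = (\<Sum>k\<in>UNIV. (\<Sum>i\<in>UNIV. H k i x * \<alpha> [i] [] x) * cnj (\<beta> [k] [] x))"
  unfolding form_inner_def One_nat_def sum_length_1
  by (simp add: H_def sum_distrib_left sum_distrib_right ac_simps) (rule sum.swap)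

lemma form_inner_0_1: "form_inner 0 1 b \<alpha> \<beta> x = (\<Sum>k\<in>UNIV. (\<Sum>i\<in>UNIV. H i k x * \<alpha> [] [i] x) * cnj (\<beta> [] [k] x))"
  unfolding form_inner_def One_nat_def sum_length_1
  by (simp add: H_def sum_distrib_left sum_distrib_right ac_simps) (rule sum.swap)

text \<open>
  The matrix of \<open>\<omega>\<close> is \<open>\<i> G\<close>, and \<open>G\<close> cancels one of the two factors \<open>H\<close> of the inner product.
\<close>

lemma form_inner_fundamental:
  assumes x: "x \<in> V"
  shows "form_inner 1 1 b (fundamental_form b) \<beta> x = \<i> * (\<Sum>k\<in>UNIV. \<Sum>l\<in>UNIV. H k l x * cnj (\<beta> [k] [l] x))"
proof -
  have "form_inner 1 1 b (fundamental_form b) \<beta> x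
    = (\<Sum>i\<in>UNIV. \<Sum>j\<in>UNIV. \<Sum>k\<in>UNIV. \<Sum>l\<in>UNIV. \<i> * G i j x * cnj (\<beta> [k] [l] x) * H k i x * H j l x)"
    unfolding form_inner_def One_nat_def sum_length_1 by (simp add: H_def fundamental_form_eq[OF x])
  also have "\<dots> = (\<Sum>i\<in>UNIV. \<Sum>k\<in>UNIV. \<Sum>l\<in>UNIV. \<Sum>j\<in>UNIV. \<i> * G i j x * cnj (\<beta> [k] [l] x) * H k i x * H j l x)"
    by (rule sum.cong[OF refl], subst sum.swap, rule sum.cong[OF refl], rule sum.swap)
  also have "\<dots> = (\<Sum>i\<in>UNIV. \<Sum>k\<in>UNIV. \<Sum>l\<in>UNIV. \<i> * cnj (\<beta> [k] [l] x) * H k i x * (\<Sum>j\<in>UNIV. G i j x * H j l x))"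
    by (simp add: sum_distrib_left ac_simps)
  also have "\<dots> = (\<Sum>i\<in>UNIV. \<Sum>k\<in>UNIV. \<i> * cnj (\<beta> [k] [i] x) * H k i x)"
    by (simp add: GH[OF x] if_distrib cong: if_cong)
  also have "\<dots> = (\<Sum>k\<in>UNIV. \<Sum>i\<in>UNIV. \<i> * cnj (\<beta> [k] [i] x) * H k i x)"
    by (rule sum.swap)
  finally show ?thesis by (simp add: sum_distrib_left ac_simps)
qed

text \<open>
  A form defined by choice as a solution of the weak equation \<open>\<langle>\<beta>, \<eta>\<rangle> = R \<eta>\<close> has the components \<open>\<sigma>\<close>, once
  \<open>R \<eta>\<close> has been computed as \<open>\<langle>\<sigma>, \<eta>\<rangle>\<close>. Existence is this computation. For uniqueness, the weak equation
  determines \<open>\<Sum> N\<^sub>k\<^sub>i \<beta>\<^sub>i\<close> for all \<open>k\<close>, and the matrix \<open>N\<close> of the inner product is invertible, with inverse \<open>E\<close>.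
  The lists \<open>a i\<close> and \<open>d i\<close> are the unbarred and barred indices of the \<open>i\<close>-th component: \<open>[i]\<close> and \<open>[]\<close> in
  degree \<open>(1,0)\<close>, and \<open>[]\<close> and \<open>[i]\<close> in degree \<open>(0,1)\<close>.
\<close>

lemma formal_adjoint_eq:
  fixes N :: "'n \<Rightarrow> 'n \<Rightarrow> complex^'n \<Rightarrow> complex" and \<sigma> :: "'n \<Rightarrow> complex^'n \<Rightarrow> complex"
  assumes pq: "p + q = 1"
    and a: "\<And>k. length (a k) = p \<and> length (d k) = q"
    and ad: "\<And>k. hd (a k @ d k) = k" "\<And>is js. length is = p \<Longrightarrow> length js = q \<Longrightarrow> \<exists>k. is = a k \<and> js = d k"
    and N: "\<And>k i. smooth_on (N k i) V" "\<And>x i j. x \<in> V \<Longrightarrow> (\<Sum>k\<in>UNIV. E i k x * N k j x) = (if i = j then 1 else 0)"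
    and inner: "\<And>\<alpha> \<beta> x. form_inner p q b \<alpha> \<beta> x = (\<Sum>k\<in>UNIV. (\<Sum>i\<in>UNIV. N k i x * \<alpha> (a i) (d i) x) * cnj (\<beta> (a k) (d k) x))"
    and \<sigma>: "\<And>i. smooth_on (\<sigma> i) V"
    and rhs: "\<And>\<eta>. test_form p q V \<eta> \<Longrightarrow> R \<eta> =
      (LINT x:V|lborel. (\<Sum>k\<in>UNIV. (2 ^ CARD('n) * D x * (\<Sum>i\<in>UNIV. N k i x * \<sigma> i x)) * cnj (\<eta> (a k) (d k) x)))"
    and \<beta>: "\<beta> = (SOME \<beta>. form_on p q V \<beta> \<and> (\<forall>\<eta>. test_form p q V \<eta> \<longrightarrow> L2_inner p q V b \<beta> \<eta> = R \<eta>))"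
    and x: "x \<in> V"
  shows "\<beta> (a i) (d i) x = \<sigma> i x"
proof -
  let ?P = "\<lambda>\<beta>. form_on p q V \<beta> \<and> (\<forall>\<eta>. test_form p q V \<eta> \<longrightarrow> L2_inner p q V b \<beta> \<eta> = R \<eta>)"
  have L2: "L2_inner p q V b \<beta> \<eta> = (LINT x:V|lborel.
      (\<Sum>k\<in>UNIV. (2 ^ CARD('n) * D x * (\<Sum>i\<in>UNIV. N k i x * \<beta> (a i) (d i) x)) * cnj (\<eta> (a k) (d k) x)))" for \<beta> \<eta>
    unfolding L2_inner_def inner D_def by (simp add: sum_distrib_left sum_distrib_right ac_simps)
  have "?P (\<lambda>is js. \<sigma> (hd (is @ js)))"
    using rhs by (auto simp: form_on_vector[OF pq] \<sigma> L2 ad)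
  then have P: "?P \<beta>" unfolding \<beta> by (rule someI[of ?P])
  have sm: "smooth_on (\<beta> (a i) (d i)) V" for i
    using P a by (auto simp: form_on_vector[OF pq])
  have S: "smooth_on (\<lambda>x. 2 ^ CARD('n) * D x * (\<Sum>i\<in>UNIV. N k i x * F i x)) V" if "\<And>i. smooth_on (F i) V" for k F
    by (intro smooth_on_mult smooth_on_sum V smooth_on_const smooth_D N that)
  have "2 ^ CARD('n) * D x * (\<Sum>i\<in>UNIV. N k i x * \<beta> (a i) (d i) x)
      = 2 ^ CARD('n) * D x * (\<Sum>i\<in>UNIV. N k i x * \<sigma> i x)" for k
  proof (rule eq_if_weakly_eq[OF V _ _ _ x])
    fix \<psi> assume "test_family V (\<psi> :: 'n \<Rightarrow> complex^'n \<Rightarrow> complex)"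
    then have t: "test_form p q V (\<lambda>is js x. cnj (\<psi> (hd (is @ js)) x))"
      by (rule test_form_of_family[OF pq])
    then show "(LINT x:V|lborel. (\<Sum>k\<in>UNIV. 2 ^ CARD('n) * D x * (\<Sum>i\<in>UNIV. N k i x * \<beta> (a i) (d i) x) * \<psi> k x))
      = (LINT x:V|lborel. (\<Sum>k\<in>UNIV. 2 ^ CARD('n) * D x * (\<Sum>i\<in>UNIV. N k i x * \<sigma> i x) * \<psi> k x))"
      using P rhs[OF t] L2[of \<beta> "\<lambda>is js x. cnj (\<psi> (hd (is @ js)) x)"] by (simp add: ad)
  qed (intro smooth_on_imp_continuous_on S sm \<sigma>)+
  then have eq: "(\<Sum>i\<in>UNIV. N k i x * \<beta> (a i) (d i) x) = (\<Sum>i\<in>UNIV. N k i x * \<sigma> i x)" for k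
    using D_nz[OF x] by simp
  have inv: "(\<Sum>k\<in>UNIV. E i k x * (\<Sum>j\<in>UNIV. N k j x * F j)) = F i" for F i
  proof -
    have "(\<Sum>k\<in>UNIV. E i k x * (\<Sum>j\<in>UNIV. N k j x * F j)) = (\<Sum>j\<in>UNIV. (\<Sum>k\<in>UNIV. E i k x * N k j x) * F j)"
      by (simp add: sum_distrib_left sum_distrib_right mult.assoc) (rule sum.swap)
    then show ?thesis by (simp add: N(2)[OF x] if_distrib if_distribR cong: if_cong)
  qed
  show ?thesis
    using inv[of i "\<lambda>j. \<beta> (a j) (d j) x"] inv[of i "\<lambda>j. \<sigma> j x"] by (simp add: eq)
qed

lemma smooth_HD: "smooth_on (\<lambda>y. z * (H k l y * D y)) V"
  by (intro smooth_on_mult smooth_on_const V smooth_H smooth_D)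

text \<open>
  The constant \<open>z\<close> collects the factor \<open>\<i>\<close> of \<open>\<omega>\<close>, the sign of \<open>delbar\<close> on \<open>(1,0)\<close>-forms and the factor \<open>2\<^sup>n\<close>
  of the volume. Conjugating \<open>delbar \<eta>\<close> turns the derivatives of the test form into \<open>\<partial>\<^sub>l\<close>; integrating by
  parts leaves the divergence of \<open>H D\<close>.
\<close>

lemma delbar_adj_fundamental_form:
  assumes x: "x \<in> V"
  shows "delbar_adj 1 1 V b (fundamental_form b) [i] [] x = \<i> * tau i x"
proof (rule formal_adjoint_eq[where p = 1 and q = 0 and a = "\<lambda>i. [i]" and d = "\<lambda>i. []"
      and N = H and E = G and \<sigma> = "\<lambda>i x. \<i> * tau i x"
      and R = "\<lambda>\<eta>. L2_inner 1 1 V b (fundamental_form b) (delbar \<eta>)"])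
  fix \<eta> assume \<eta>: "test_form 1 0 V (\<eta> :: 'n tensor)"
  define \<psi> where "\<psi> k x = cnj (\<eta> [k] [] x)" for k x
  have \<psi>: "test_family V \<psi>"
    unfolding \<psi>_def[abs_def] by (rule test_family_of_form[OF _ \<eta>]) auto
  have sm\<eta>: "smooth_on (\<eta> [k] []) V" for k
    using \<eta> by (auto simp: test_form_def form_on_def intro: smooth_on_subset[OF _ subset_UNIV])
  define z :: complex where "z = - \<i> * 2 ^ CARD('n)"
  have "L2_inner 1 1 V b (fundamental_form b) (delbar \<eta>)
    = (LINT x:V|lborel. (\<Sum>k\<in>UNIV. \<Sum>l\<in>UNIV. (z * (H k l x * D x)) * wirtinger (- \<i>) l (\<psi> k) x))"
    unfolding L2_inner_def
  proof (rule set_lebesgue_integral_cong)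
    show "V \<in> sets lborel" using V by simp
    show "\<forall>x. x \<in> V \<longrightarrow> form_inner 1 1 b (fundamental_form b) (delbar \<eta>) x * (2 ^ CARD('n) * det (metric_matrix b x))
      = (\<Sum>k\<in>UNIV. \<Sum>l\<in>UNIV. (z * (H k l x * D x)) * wirtinger (- \<i>) l (\<psi> k) x)"
    proof (intro allI impI)
      fix x assume x: "x \<in> V"
      have "cnj (delbar \<eta> [k] [l] x) = - wirtinger (- \<i>) l (\<psi> k) x" for k l
        using wirtinger_cnj[OF V x sm\<eta>, of "- \<i>" l]
        by (simp add: delbar_def remove_nth_def dzbar_eq_wirtinger \<psi>_def[abs_def])
      then show "form_inner 1 1 b (fundamental_form b) (delbar \<eta>) x * (2 ^ CARD('n) * det (metric_matrix b x))
        = (\<Sum>k\<in>UNIV. \<Sum>l\<in>UNIV. (z * (H k l x * D x)) * wirtinger (- \<i>) l (\<psi> k) x)"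
        by (simp add: form_inner_fundamental[OF x, unfolded One_nat_def] D_def[symmetric] z_def sum_negf sum_distrib_left
            sum_distrib_right ac_simps)
    qed
  qed
  also have "\<dots> = - (LINT x:V|lborel. (\<Sum>k\<in>UNIV. (\<Sum>l\<in>UNIV. wirtinger (- \<i>) l (\<lambda>x. z * (H k l x * D x)) x) * \<psi> k x))"
    by (rule integral_by_parts_family[OF V \<psi> smooth_HD])
  also have "\<dots> = - (LINT x:V|lborel. (\<Sum>k\<in>UNIV. (z * (D x * (\<Sum>i\<in>UNIV. H k i x * tau i x))) * \<psi> k x))"
  proof -
    have "(\<Sum>l\<in>UNIV. wirtinger (- \<i>) l (\<lambda>x. z * (H k l x * D x)) x) = z * (D x * (\<Sum>i\<in>UNIV. H k i x * tau i x))"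
      if "x \<in> V" for x k
      using divergence_H[OF that, of k]
      by (simp add: wirtinger_cmult[OF V that smooth_on_mult[OF V smooth_H smooth_D]] flip: sum_distrib_left)
    then show ?thesis
      by (intro arg_cong[where f = uminus] set_lebesgue_integral_cong) (use V in simp_all)
  qed
  also have "\<dots> = (LINT x:V|lborel. - (\<Sum>k\<in>UNIV. (z * (D x * (\<Sum>i\<in>UNIV. H k i x * tau i x))) * \<psi> k x))"
    by (simp add: set_lebesgue_integral_def)
  also have "\<dots> = (LINT x:V|lborel. (\<Sum>k\<in>UNIV. (2 ^ CARD('n) * D x * (\<Sum>i\<in>UNIV. H k i x * (\<i> * tau i x))) * cnj (\<eta> [k] [] x)))"
    by (simp add: z_def \<psi>_def sum_negf sum_distrib_left sum_distrib_right ac_simps)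
  finally show "L2_inner 1 1 V b (fundamental_form b) (delbar \<eta>) = \<dots>" .
next
  show "(\<Sum>k\<in>UNIV. G i k x * H k j x) = (if i = j then 1 else 0)" if "x \<in> V" for x i j
    by (rule GH[OF that])
  show "\<exists>k. is = [k] \<and> js = []" if "length is = 1" "length js = 0" for "is" js :: "'n list"
    using that by (auto simp: length_Suc_conv)
qed (simp_all add: smooth_H form_inner_1_0[unfolded One_nat_def] smooth_on_mult smooth_on_const V smooth_tau x delbar_adj_def)

lemma del_adj_fundamental_form:
  assumes x: "x \<in> V"
  shows "del_adj 1 1 V b (fundamental_form b) [] [i] x = - \<i> * cnj (tau i x)"
proof (rule formal_adjoint_eq[where p = 0 and q = 1 and a = "\<lambda>i. []" and d = "\<lambda>i. [i]"
      and N = "\<lambda>k i. H i k" and E = "\<lambda>i k. G k i" and \<sigma> = "\<lambda>i x. - \<i> * cnj (tau i x)"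
      and R = "\<lambda>\<eta>. L2_inner 1 1 V b (fundamental_form b) (del \<eta>)"])
  fix \<eta> assume \<eta>: "test_form 0 1 V (\<eta> :: 'n tensor)"
  define \<psi> where "\<psi> k x = cnj (\<eta> [] [k] x)" for k x
  have \<psi>: "test_family V \<psi>"
    unfolding \<psi>_def[abs_def] by (rule test_family_of_form[OF _ \<eta>]) auto
  have sm\<eta>: "smooth_on (\<eta> [] [k]) V" for k
    using \<eta> by (auto simp: test_form_def form_on_def intro: smooth_on_subset[OF _ subset_UNIV])
  define z :: complex where "z = \<i> * 2 ^ CARD('n)"
  have "L2_inner 1 1 V b (fundamental_form b) (del \<eta>)
    = (LINT x:V|lborel. (\<Sum>k\<in>UNIV. \<Sum>l\<in>UNIV. (z * (H l k x * D x)) * wirtinger \<i> l (\<psi> k) x))"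
    unfolding L2_inner_def
  proof (rule set_lebesgue_integral_cong)
    show "V \<in> sets lborel" using V by simp
    show "\<forall>x. x \<in> V \<longrightarrow> form_inner 1 1 b (fundamental_form b) (del \<eta>) x * (2 ^ CARD('n) * det (metric_matrix b x))
      = (\<Sum>k\<in>UNIV. \<Sum>l\<in>UNIV. (z * (H l k x * D x)) * wirtinger \<i> l (\<psi> k) x)"
    proof (intro allI impI)
      fix x assume x: "x \<in> V"
      have "cnj (del \<eta> [l] [k] x) = wirtinger \<i> l (\<psi> k) x" for k l
        using wirtinger_cnj[OF V x sm\<eta>, of "\<i>" l]
        by (simp add: del_def remove_nth_def dz_eq_wirtinger \<psi>_def[abs_def])
      then show "form_inner 1 1 b (fundamental_form b) (del \<eta>) x * (2 ^ CARD('n) * det (metric_matrix b x))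
        = (\<Sum>k\<in>UNIV. \<Sum>l\<in>UNIV. (z * (H l k x * D x)) * wirtinger \<i> l (\<psi> k) x)"
        by (simp add: form_inner_fundamental[OF x, unfolded One_nat_def] D_def[symmetric] z_def sum_distrib_left
            sum_distrib_right ac_simps) (rule sum.swap)
    qed
  qed
  also have "\<dots> = - (LINT x:V|lborel. (\<Sum>k\<in>UNIV. (\<Sum>l\<in>UNIV. wirtinger \<i> l (\<lambda>x. z * (H l k x * D x)) x) * \<psi> k x))"
    by (rule integral_by_parts_family[OF V \<psi> smooth_HD])
  also have "\<dots> = - (LINT x:V|lborel. (\<Sum>k\<in>UNIV. (z * (D x * (\<Sum>i\<in>UNIV. H i k x * cnj (tau i x)))) * \<psi> k x))"
  proof -
    have "(\<Sum>l\<in>UNIV. wirtinger \<i> l (\<lambda>x. z * (H l k x * D x)) x) = z * (D x * (\<Sum>i\<in>UNIV. H i k x * cnj (tau i x)))"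
      if "x \<in> V" for x k
      using divergence_H_cnj[OF that, of k]
      by (simp add: wirtinger_cmult[OF V that smooth_on_mult[OF V smooth_H smooth_D]] flip: sum_distrib_left)
    then show ?thesis
      by (intro arg_cong[where f = uminus] set_lebesgue_integral_cong) (use V in simp_all)
  qed
  also have "\<dots> = (LINT x:V|lborel. - (\<Sum>k\<in>UNIV. (z * (D x * (\<Sum>i\<in>UNIV. H i k x * cnj (tau i x)))) * \<psi> k x))"
    by (simp add: set_lebesgue_integral_def)
  also have "\<dots> = (LINT x:V|lborel. (\<Sum>k\<in>UNIV. (2 ^ CARD('n) * D x * (\<Sum>i\<in>UNIV. H i k x * (- \<i> * cnj (tau i x)))) * cnj (\<eta> [] [k] x)))"
    by (simp add: z_def \<psi>_def sum_negf sum_distrib_left sum_distrib_right ac_simps)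
  finally show "L2_inner 1 1 V b (fundamental_form b) (del \<eta>) = \<dots>" .
next
  show "(\<Sum>k\<in>UNIV. G k i x * H j k x) = (if i = j then 1 else 0)" if "x \<in> V" for x i j
    using HG[OF that, of j i] by (simp add: mult.commute eq_commute)
  show "\<exists>k. is = [] \<and> js = [k]" if "length is = 0" "length js = 1" for "is" js :: "'n list"
    using that by (auto simp: length_Suc_conv)
  show "smooth_on (\<lambda>x. - \<i> * cnj (tau i x)) V" for i
    by (intro smooth_on_mult smooth_on_const V smooth_on_cnj smooth_tau)
qed (simp_all add: smooth_H form_inner_0_1[unfolded One_nat_def] x del_adj_def)

end

section \<open>The Bismut Einstein equation\<close>

context hermitian_chart
begin

definition L :: "complex^'n \<Rightarrow> complex" where
  "L y = Ln (D y)"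

lemma smooth_L: "smooth_on L V"
  unfolding L_def[abs_def]
proof (rule smooth_on_Ln[OF V smooth_D])
  show "D y \<notin> \<real>\<^sub>\<le>\<^sub>0" if "y \<in> V" for y
    using D_pos[OF that] by (auto simp: complex_nonpos_Reals_iff)
qed

text \<open>
  The sign of \<open>delbar\<close> on \<open>(1,0)\<close>-forms makes the two torsion terms appear with equal signs.
\<close>

lemma rho11_eq:
  assumes x: "x \<in> V"
  shows "rho11 V b [i] [j] x = \<i> * (wirtinger (- \<i>) i (\<lambda>y. cnj (tau j y)) x + wirtinger \<i> j (tau i) x
      - wirtinger (- \<i>) i (wirtinger \<i> j L) x)"
proof -
  have "wirtinger (- \<i>) i (del_adj 1 1 V b (fundamental_form b) [] [j]) x
      = wirtinger (- \<i>) i (\<lambda>y. - \<i> * cnj (tau j y)) x"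
    by (rule wirtinger_cong[OF V x]) (rule del_adj_fundamental_form)
  also have "\<dots> = - \<i> * wirtinger (- \<i>) i (\<lambda>y. cnj (tau j y)) x"
    by (rule wirtinger_cmult[OF V x smooth_on_cnj[OF V smooth_tau]])
  finally have 1: "del (del_adj 1 1 V b (fundamental_form b)) [i] [j] x
      = - \<i> * wirtinger (- \<i>) i (\<lambda>y. cnj (tau j y)) x"
    by (simp add: del_def remove_nth_def dz_eq_wirtinger)
  have "wirtinger \<i> j (delbar_adj 1 1 V b (fundamental_form b) [i] []) x = wirtinger \<i> j (\<lambda>y. \<i> * tau i y) x"
    by (rule wirtinger_cong[OF V x]) (rule delbar_adj_fundamental_form)
  also have "\<dots> = \<i> * wirtinger \<i> j (tau i) x"
    by (rule wirtinger_cmult[OF V x smooth_tau])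
  finally have 2: "delbar (delbar_adj 1 1 V b (fundamental_form b)) [i] [j] x = - \<i> * wirtinger \<i> j (tau i) x"
    by (simp add: delbar_def remove_nth_def dzbar_eq_wirtinger)
  have 3: "del (delbar (log_det b)) [i] [j] x = wirtinger (- \<i>) i (wirtinger \<i> j L) x"
    by (simp add: del_def delbar_def[abs_def] remove_nth_def dzbar_eq_wirtinger[abs_def] dz_eq_wirtinger
        log_det_def[abs_def] L_def[abs_def] D_def[abs_def])
  show ?thesis unfolding rho11_def 1 2 3 by (simp add: algebra_simps)
qed

lemma phi_eq:
  assumes x: "x \<in> V"
  shows "phi V b [i, j] [] x = wirtinger (- \<i>) j (tau i) x - wirtinger (- \<i>) i (tau j) x"
proof -
  have "wirtinger (- \<i>) i (delbar_adj 1 1 V b (fundamental_form b) [j] []) x = \<i> * wirtinger (- \<i>) i (tau j) x" for i j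
  proof -
    have "wirtinger (- \<i>) i (delbar_adj 1 1 V b (fundamental_form b) [j] []) x = wirtinger (- \<i>) i (\<lambda>y. \<i> * tau j y) x"
      by (rule wirtinger_cong[OF V x]) (rule delbar_adj_fundamental_form)
    also have "\<dots> = \<i> * wirtinger (- \<i>) i (tau j) x"
      by (rule wirtinger_cmult[OF V x smooth_tau])
    finally show ?thesis .
  qed
  then show ?thesis
    by (simp add: phi_def rho20_def del_def remove_nth_def dz_eq_wirtinger algebra_simps)
qed

text \<open>
  The equation \<open>E\<close> below is \<open>\<rho>\<^sup>1\<^sup>,\<^sup>1 = \<lambda> \<omega>\<close> solved for \<open>\<partial>\<^sub>k' \<tau>\<^sub>i\<close>. Apply \<open>\<partial>\<^sub>j\<close> and antisymmetrise in \<open>i\<close> and \<open>j\<close>: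
  the terms with \<open>\<partial>\<^sub>j \<partial>\<^sub>i\<close> cancel, and \<open>\<partial>\<^sub>j G\<^sub>i\<^sub>k - \<partial>\<^sub>i G\<^sub>j\<^sub>k = - T\<^sub>i\<^sub>j\<^sub>k\<close> remains.
\<close>

lemma dzbar_phi:
  assumes x: "x \<in> V"
    and einstein: "\<And>x i j. x \<in> V \<Longrightarrow> rho11 V b [i] [j] x = of_real l * fundamental_form b [i] [j] x"
  shows "wirtinger \<i> k (phi V b [i, j] []) x = - of_real l * T i j k x"
proof -
  have E: "wirtinger \<i> k (tau i) y = of_real l * G i k y + wirtinger (- \<i>) i (wirtinger \<i> k L) y
      - wirtinger (- \<i>) i (\<lambda>y. cnj (tau k y)) y" if "y \<in> V" for i y
  proof -
    have "\<i> * (wirtinger (- \<i>) i (\<lambda>y. cnj (tau k y)) y + wirtinger \<i> k (tau i) y - wirtinger (- \<i>) i (wirtinger \<i> k L) y)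
        = \<i> * (of_real l * G i k y)"
      using einstein[OF that, of i k]
      unfolding rho11_eq[OF that] fundamental_form_eq[OF that] by (simp only: mult.left_commute)
    then have "wirtinger (- \<i>) i (\<lambda>y. cnj (tau k y)) y + wirtinger \<i> k (tau i) y - wirtinger (- \<i>) i (wirtinger \<i> k L) y
        = of_real l * G i k y" by simp
    then show ?thesis by (simp add: algebra_simps)
  qed
  have sm: "smooth_on (wirtinger \<i> k L) V" "smooth_on (\<lambda>y. cnj (tau k y)) V"
    by (intro smooth_on_wirtinger V smooth_L smooth_on_cnj smooth_tau)+
  have d: "wirtinger \<i> k (wirtinger (- \<i>) j (tau i)) x = of_real l * wirtinger (- \<i>) j (G i k) x
      + wirtinger (- \<i>) j (wirtinger (- \<i>) i (wirtinger \<i> k L)) x - wirtinger (- \<i>) j (wirtinger (- \<i>) i (\<lambda>y. cnj (tau k y))) x" for i j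
  proof -
    have "wirtinger \<i> k (wirtinger (- \<i>) j (tau i)) x = wirtinger (- \<i>) j (wirtinger \<i> k (tau i)) x"
      by (rule wirtinger_commute[OF V x smooth_tau])
    also have "\<dots> = wirtinger (- \<i>) j (\<lambda>y. of_real l * G i k y + wirtinger (- \<i>) i (wirtinger \<i> k L) y
      - wirtinger (- \<i>) i (\<lambda>y. cnj (tau k y)) y) x"
      by (rule wirtinger_cong[OF V x E])
    also have "\<dots> = wirtinger (- \<i>) j (\<lambda>y. of_real l * G i k y + wirtinger (- \<i>) i (wirtinger \<i> k L) y) x
        - wirtinger (- \<i>) j (wirtinger (- \<i>) i (\<lambda>y. cnj (tau k y))) x"
      by (rule wirtinger_diff[OF V x]) (intro smooth_on_add smooth_on_mult smooth_on_const smooth_on_wirtinger V smooth_G sm)+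
    also have "wirtinger (- \<i>) j (\<lambda>y. of_real l * G i k y + wirtinger (- \<i>) i (wirtinger \<i> k L) y) x
        = wirtinger (- \<i>) j (\<lambda>y. of_real l * G i k y) x + wirtinger (- \<i>) j (wirtinger (- \<i>) i (wirtinger \<i> k L)) x"
      by (rule wirtinger_add[OF V x]) (intro smooth_on_mult smooth_on_const smooth_on_wirtinger V smooth_G sm)+
    also have "wirtinger (- \<i>) j (\<lambda>y. of_real l * G i k y) x = of_real l * wirtinger (- \<i>) j (G i k) x"
      by (rule wirtinger_cmult[OF V x smooth_G])
    finally show ?thesis .
  qed
  have "wirtinger \<i> k (phi V b [i, j] []) x = wirtinger \<i> k (\<lambda>y. wirtinger (- \<i>) j (tau i) y - wirtinger (- \<i>) i (tau j) y) x"
    by (rule wirtinger_cong[OF V x phi_eq])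
  also have "\<dots> = wirtinger \<i> k (wirtinger (- \<i>) j (tau i)) x - wirtinger \<i> k (wirtinger (- \<i>) i (tau j)) x"
    by (rule wirtinger_diff[OF V x]) (intro smooth_on_wirtinger V smooth_tau)+
  finally show ?thesis
    unfolding d wirtinger_commute[OF V x sm(1), of "- \<i>" j "- \<i>" i] wirtinger_commute[OF V x sm(2), of "- \<i>" j "- \<i>" i]
    by (simp add: T_def algebra_simps)
qed

definition \<Gamma> :: "'n \<Rightarrow> 'n \<Rightarrow> 'n \<Rightarrow> complex^'n \<Rightarrow> complex" where
  "\<Gamma> i j s y = (\<Sum>t\<in>UNIV. H t s y * wirtinger (- \<i>) i (G j t) y)"

lemma christoffel_eq: "christoffel b i j s y = \<Gamma> i j s y"
  by (simp add: christoffel_def \<Gamma>_def H_def dz_eq_wirtinger G_def[abs_def])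

lemma T_antisym: "T j i k y = - T i j k y"
  by (simp add: T_def)

text \<open>
  Up to a factor \<open>T\<close> is the form \<open>del \<omega>\<close>, so this is \<open>del (del \<omega>) = 0\<close>, solved for one of the three
  cyclic terms.
\<close>

lemma wirtinger_T_cyclic:
  assumes x: "x \<in> V"
  shows "wirtinger (- \<i>) p (T i j k) x = wirtinger (- \<i>) j (T i p k) x - wirtinger (- \<i>) i (T j p k) x"
proof -
  have "wirtinger (- \<i>) p (T i j k) x = wirtinger (- \<i>) p (wirtinger (- \<i>) i (G j k)) x - wirtinger (- \<i>) p (wirtinger (- \<i>) j (G i k)) x" for p i j
    unfolding T_def[abs_def] by (rule wirtinger_diff[OF V x]) (intro smooth_on_wirtinger V smooth_G)+
  then show ?thesis
    using wirtinger_commute[OF V x smooth_G, of "- \<i>" p "- \<i>" i j k] wirtinger_commute[OF V x smooth_G, of "- \<i>" p "- \<i>" j i k]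
      wirtinger_commute[OF V x smooth_G, of "- \<i>" i "- \<i>" j p k] by simp
qed

text \<open>
  The derivative of the factor \<open>H\<close> of \<open>\<tau>\<close> is \<open>- H (\<partial> G) H\<close>, in which \<open>(\<partial> G) H\<close> is a Christoffel symbol.
\<close>

lemma wirtinger_tau:
  assumes x: "x \<in> V"
  shows "wirtinger (- \<i>) i (tau j) x = (\<Sum>p\<in>UNIV. \<Sum>q\<in>UNIV. H q p x * wirtinger (- \<i>) i (T j p q) x)
     - (\<Sum>p\<in>UNIV. \<Sum>q\<in>UNIV. \<Sum>s\<in>UNIV. H q p x * \<Gamma> i p s x * T j s q x)"
proof -
  have dH: "wirtinger (- \<i>) i (H q p) x = - (\<Sum>a\<in>UNIV. H q a x * \<Gamma> i a p x)" for p q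
    by (simp add: wirtinger_H[OF x] \<Gamma>_def sum_distrib_left ac_simps)
  have "wirtinger (- \<i>) i (tau j) x = (\<Sum>p\<in>UNIV. \<Sum>q\<in>UNIV. wirtinger (- \<i>) i (\<lambda>y. H q p y * T j p q y) x)"
    unfolding tau_def[abs_def]
    by (simp add: wirtinger_sum[OF V x] smooth_on_sum smooth_on_mult V smooth_H smooth_T)
  also have "\<dots> = (\<Sum>p\<in>UNIV. \<Sum>q\<in>UNIV. H q p x * wirtinger (- \<i>) i (T j p q) x
        - (\<Sum>a\<in>UNIV. H q a x * \<Gamma> i a p x * T j p q x))"
    by (simp add: wirtinger_mult[OF V x smooth_H smooth_T] dH sum_distrib_right)
  also have "\<dots> = (\<Sum>p\<in>UNIV. \<Sum>q\<in>UNIV. H q p x * wirtinger (- \<i>) i (T j p q) x)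
     - (\<Sum>p\<in>UNIV. \<Sum>q\<in>UNIV. \<Sum>a\<in>UNIV. H q a x * \<Gamma> i a p x * T j p q x)"
    by (simp add: sum_subtractf)
  also have "(\<Sum>p\<in>UNIV. \<Sum>q\<in>UNIV. \<Sum>a\<in>UNIV. H q a x * \<Gamma> i a p x * T j p q x)
     = (\<Sum>p\<in>UNIV. \<Sum>a\<in>UNIV. \<Sum>q\<in>UNIV. H q a x * \<Gamma> i a p x * T j p q x)"
    by (rule sum.cong[OF refl], rule sum.swap)
  also have "\<dots> = (\<Sum>a\<in>UNIV. \<Sum>p\<in>UNIV. \<Sum>q\<in>UNIV. H q a x * \<Gamma> i a p x * T j p q x)"
    by (rule sum.swap)
  also have "\<dots> = (\<Sum>a\<in>UNIV. \<Sum>q\<in>UNIV. \<Sum>p\<in>UNIV. H q a x * \<Gamma> i a p x * T j p q x)"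
    by (rule sum.cong[OF refl], rule sum.swap)
  finally show ?thesis .
qed

text \<open>
  The difference of Christoffel symbols is the torsion with its last index raised, so the left-hand
  side is \<open>\<Sum> H\<^sub>q\<^sub>p H\<^sub>t\<^sub>s T\<^sub>i\<^sub>p\<^sub>t T\<^sub>j\<^sub>s\<^sub>q\<close>. Renaming \<open>(p, q)\<close> to \<open>(s, t)\<close> and conversely exchanges \<open>i\<close> and \<open>j\<close>.
\<close>

lemma trace_torsion_square:
  "(\<Sum>p\<in>UNIV. \<Sum>q\<in>UNIV. \<Sum>s\<in>UNIV. H q p x * (\<Gamma> i p s x - \<Gamma> p i s x) * T j s q x)
 = (\<Sum>p\<in>UNIV. \<Sum>q\<in>UNIV. \<Sum>s\<in>UNIV. H q p x * (\<Gamma> j p s x - \<Gamma> p j s x) * T i s q x)"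
proof -
  have T2: "\<Gamma> i p s x - \<Gamma> p i s x = (\<Sum>t\<in>UNIV. H t s x * T i p t x)" for i p s
    by (simp add: \<Gamma>_def T_def right_diff_distrib sum_subtractf)
  define F where "F i j p q s t = H q p x * (H t s x * T i p t x) * T j s q x" for i j p q s t
  have "(\<Sum>p\<in>UNIV. \<Sum>q\<in>UNIV. \<Sum>s\<in>UNIV. \<Sum>t\<in>UNIV. F i j p q s t) = (\<Sum>p\<in>UNIV. \<Sum>s\<in>UNIV. \<Sum>q\<in>UNIV. \<Sum>t\<in>UNIV. F i j p q s t)"
    by (rule sum.cong[OF refl], rule sum.swap)
  also have "\<dots> = (\<Sum>s\<in>UNIV. \<Sum>p\<in>UNIV. \<Sum>q\<in>UNIV. \<Sum>t\<in>UNIV. F i j p q s t)"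
    by (rule sum.swap)
  also have "\<dots> = (\<Sum>s\<in>UNIV. \<Sum>p\<in>UNIV. \<Sum>t\<in>UNIV. \<Sum>q\<in>UNIV. F i j p q s t)"
    by (rule sum.cong[OF refl], rule sum.cong[OF refl], rule sum.swap)
  also have "\<dots> = (\<Sum>s\<in>UNIV. \<Sum>t\<in>UNIV. \<Sum>p\<in>UNIV. \<Sum>q\<in>UNIV. F i j p q s t)"
    by (rule sum.cong[OF refl], rule sum.swap)
  also have "\<dots> = (\<Sum>s\<in>UNIV. \<Sum>t\<in>UNIV. \<Sum>p\<in>UNIV. \<Sum>q\<in>UNIV. F j i s t p q)"
    by (simp add: F_def ac_simps)
  finally have "(\<Sum>p\<in>UNIV. \<Sum>q\<in>UNIV. \<Sum>s\<in>UNIV. \<Sum>t\<in>UNIV. F i j p q s t)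
     = (\<Sum>p\<in>UNIV. \<Sum>q\<in>UNIV. \<Sum>s\<in>UNIV. \<Sum>t\<in>UNIV. F j i p q s t)" .
  then show ?thesis
    by (simp add: T2 F_def sum_distrib_left sum_distrib_right)
qed

text \<open>
  Expand by \<open>wirtinger_T_cyclic\<close> and compare with \<open>wirtinger_tau\<close>. The derivatives of \<open>T\<close> match, and the Christoffel
  terms that are left form the two sides of \<open>trace_torsion_square\<close>.
\<close>

lemma divergence_torsion:
  assumes x: "x \<in> V"
  shows "(\<Sum>p\<in>UNIV. \<Sum>q\<in>UNIV. H q p x * (wirtinger (- \<i>) p (T i j q) x
      - ((\<Sum>s\<in>UNIV. \<Gamma> p i s x * T s j q x) + (\<Sum>s\<in>UNIV. \<Gamma> p j s x * T i s q x))))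
    = wirtinger (- \<i>) j (tau i) x - wirtinger (- \<i>) i (tau j) x"
proof -
  have "(\<Sum>p\<in>UNIV. \<Sum>q\<in>UNIV. H q p x * (wirtinger (- \<i>) p (T i j q) x
      - ((\<Sum>s\<in>UNIV. \<Gamma> p i s x * T s j q x) + (\<Sum>s\<in>UNIV. \<Gamma> p j s x * T i s q x))))
    = (\<Sum>p\<in>UNIV. \<Sum>q\<in>UNIV. H q p x * wirtinger (- \<i>) j (T i p q) x)
    - (\<Sum>p\<in>UNIV. \<Sum>q\<in>UNIV. H q p x * wirtinger (- \<i>) i (T j p q) x)
    + (\<Sum>p\<in>UNIV. \<Sum>q\<in>UNIV. \<Sum>s\<in>UNIV. H q p x * \<Gamma> p i s x * T j s q x)
    - (\<Sum>p\<in>UNIV. \<Sum>q\<in>UNIV. \<Sum>s\<in>UNIV. H q p x * \<Gamma> p j s x * T i s q x)"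
    unfolding wirtinger_T_cyclic[OF x, of _ i j] T_antisym[of j]
    by (simp add: sum_distrib_left sum.distrib sum_subtractf sum_negf algebra_simps)
  also have "\<dots> = wirtinger (- \<i>) j (tau i) x - wirtinger (- \<i>) i (tau j) x"
    using trace_torsion_square[of x i j] unfolding wirtinger_tau[OF x]
    by (simp add: sum_subtractf algebra_simps)
  finally show ?thesis .
qed

lemma bismut_einstein_chart:
  assumes x: "x \<in> V"
    and einstein: "\<And>x i j. x \<in> V \<Longrightarrow> rho11 V b [i] [j] x = of_real l * fundamental_form b [i] [j] x"
  shows nabla_bar_phi: "nabla_bar b k (phi V b) [i, j] [] x = - of_real l * torsion b i j k x"
    and chern_laplacian_phi: "chern_laplacian b (phi V b) [i, j] [] x = - of_real l * phi V b [i, j] [] x"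
proof -
  have nb: "nabla_bar b k (phi V b) [i, j] [] y = - of_real l * T i j k y" if "y \<in> V" for i j k y
    using dzbar_phi[OF that einstein] by (simp add: nabla_bar_def dzbar_eq_wirtinger)
  then show "nabla_bar b k (phi V b) [i, j] [] x = - of_real l * torsion b i j k x"
    using x by (simp add: torsion_eq)
  define t where "t = nabla_bar_tensor b (phi V b)"
  have t: "t [i, j] [q] y = - of_real l * T i j q y" if "y \<in> V" for i j q y
    using nb[OF that] by (simp add: t_def nabla_bar_tensor_def)
  have "nabla b p t [i, j] [q] x = - of_real l * (wirtinger (- \<i>) p (T i j q) x
      - ((\<Sum>s\<in>UNIV. \<Gamma> p i s x * T s j q x) + (\<Sum>s\<in>UNIV. \<Gamma> p j s x * T i s q x)))" for p q
  proof -
    have "wirtinger (- \<i>) p (t [i, j] [q]) x = wirtinger (- \<i>) p (\<lambda>y. - of_real l * T i j q y) x"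
      by (rule wirtinger_cong[OF V x t])
    also have "\<dots> = - of_real l * wirtinger (- \<i>) p (T i j q) x"
      by (rule wirtinger_cmult[OF V x smooth_T])
    finally show ?thesis
      by (simp add: nabla_def dz_eq_wirtinger christoffel_eq t[OF x] lessThan_Suc sum_negf
          sum_distrib_left algebra_simps)
  qed
  then have "chern_laplacian b (phi V b) [i, j] [] x = - of_real l *
     (\<Sum>p\<in>UNIV. \<Sum>q\<in>UNIV. H q p x * (wirtinger (- \<i>) p (T i j q) x
      - ((\<Sum>s\<in>UNIV. \<Gamma> p i s x * T s j q x) + (\<Sum>s\<in>UNIV. \<Gamma> p j s x * T i s q x))))"
    by (simp only: chern_laplacian_def t_def[symmetric] H_def[symmetric]) (simp add: sum_distrib_left sum_negf ac_simps)
  then show "chern_laplacian b (phi V b) [i, j] [] x = - of_real l * phi V b [i, j] [] x"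
    by (simp add: divergence_torsion[OF x] phi_eq[OF x])
qed

end

theorem proposition5p2:
  fixes M :: "'a topology"
    and A :: "('a, 'n::finite) chart set"
    and g :: "('a, 'n) chart \<Rightarrow> 'n local_metric"
    and l :: real
  assumes "complex_manifold M A"
    and "hermitian_metric A g"
    and "bismut_einstein A g l"
  shows "(\<forall>c\<in>A. \<forall>x\<in>coord_dom c. \<forall>i j.
            chern_laplacian (g c) (phi (coord_dom c) (g c)) [i, j] [] x
              = - of_real l * phi (coord_dom c) (g c) [i, j] [] x) \<and>
         (l \<noteq> 0 \<longrightarrow>
           (\<forall>c\<in>A. \<forall>x\<in>coord_dom c. \<forall>i j k.
              of_real l * torsion (g c) i j k x
                + nabla_bar (g c) k (phi (coord_dom c) (g c)) [i, j] [] x = 0))"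
proof -
  have chart: "hermitian_chart (coord_dom c) (g c)" if "c \<in> A" for c
    using assms(1,2) that unfolding hermitian_chart_def complex_manifold_def hermitian_metric_def
    by metis
  have einstein: "rho11 (coord_dom c) (g c) [i] [j] x = of_real l * fundamental_form (g c) [i] [j] x"
    if "c \<in> A" "x \<in> coord_dom c" for c x i j
    using assms(3) that by (simp add: bismut_einstein_def)
  show ?thesis
    using hermitian_chart.nabla_bar_phi[OF chart _ einstein]
      hermitian_chart.chern_laplacian_phi[OF chart _ einstein]
    by simp
qed

end
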